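(* Let $(\mathcal{X},d)$ be a complete, separable, non-compact, locally compact length space and $p>1$. Let $(\mu_t)_{t\ge0}$ be a unit-speed ray in $P_p(\mathcal{X})$ and $\nu_0\in P_p(\mathcal{X})$. Let $\{t_n\}$ be a sequence increasing to infinity, let $\{\nu_0^n\}\subset P_p(\mathcal{X})$ with $W_p(\nu_0^n,\nu_0)\to0$, and for each $n$ let $(\nu^n_t)_{0\le t\le L_n}\in T(\nu_0^n,\mu_{t_n})$ where $L_n=W_p(\nu_0^n,\mu_{t_n})$. Then there exists a subsequence of $\{(\nu^n_t)_{0\le t\le L_n}\}$ which converges to a co-ray from $\nu_0$ to $(\mu_t)_{t\ge0}$, in the sense that along the subsequence $W_p(\nu^n_t,\nu_t)\to0$ for every $t\ge0$, where $(\nu_t)_{t\ge0}$ is such a co-ray.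
   Context: $P_p(\mathcal{X})$: Borel probability measures on $\mathcal{X}$ with finite $p$-th moment, with $W_p(\mu,\nu)=\big(\min_{\pi}\int d(x,y)^p\,d\pi\big)^{1/p}$ over couplings $\pi$ of $\mu,\nu$. In a metric space $(\mathcal{Y},d)$ a ray is a continuous $\gamma:[0,\infty)\to\mathcal{Y}$ with $d(\gamma_s,\gamma_t)=|s-t|\,d(\gamma_0,\gamma_1)$ for all $s,t\ge0$; unit-speed means $d(\gamma_0,\gamma_1)=1$. For $\mu,\nu\in P_p(\mathcal{X})$ with $L=W_p(\mu,\nu)$, $T(\mu,\nu)$ is the set of curves $(\mu_t)_{0\le t\le L}$ in $P_p(\mathcal{X})$ with $\mu_0=\mu$, $\mu_L=\nu$ and $W_p(\mu_s,\mu_t)=|s-t|$. Co-ray: given a unit-speed ray $(\mu_t)_{t\ge0}$ in $P_p(\mathcal{X})$, a ray $(\nu_t)_{t\ge0}$ is a co-ray from $\nu_0$ to $(\mu_t)_{t\ge0}$ if there exist $s_n\to+\infty$, $\lambda^n\in P_p(\mathcal{X})$ with $W_p(\lambda^n,\nu_0)\to0$, and $(\lambda^n_t)_{0\le t\le M_n}\in T(\lambda^n,\mu_{s_n})$, $M_n=W_p(\lambda^n,\mu_{s_n})$, with $W_p(\lambda^n_t,\nu_t)\to0$ for every $t\ge0$. *)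

theory Defs
  imports "HOL-Probability.Probability"
begin

definition separable_space :: "'a::metric_space itself \<Rightarrow> bool" where
  "separable_space _ \<longleftrightarrow> (\<exists>D::'a set. countable D \<and> closure D = UNIV)"

definition locally_compact :: "'a::metric_space itself \<Rightarrow> bool" where
  "locally_compact _ \<longleftrightarrow>
     (\<forall>x::'a. \<exists>U K. open U \<and> compact K \<and> x \<in> U \<and> U \<subseteq> K)"

definition curve_length :: "(real \<Rightarrow> 'a::metric_space) \<Rightarrow> real \<Rightarrow> real \<Rightarrow> ereal" where
  "curve_length g a b =
     (SUP P \<in> {(n, t). t 0 = a \<and> t n = b \<and> (\<forall>i<n. t i \<le> t (Suc i))}.
        ereal (\<Sum>i<fst P. dist (g (snd P i)) (g (snd P (Suc i)))))"

definition length_space :: "'a::metric_space itself \<Rightarrow> bool" where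
  "length_space _ \<longleftrightarrow>
     (\<forall>x y::'a. ereal (dist x y) =
        (INF g \<in> {g. continuous_on {0..1} g \<and> g 0 = x \<and> g 1 = y}. curve_length g 0 1))"

definition Pp :: "real \<Rightarrow> 'a::metric_space measure set" where
  "Pp p = {\<mu>. prob_space \<mu> \<and> sets \<mu> = sets borel \<and>
              (\<exists>x0. (\<integral>\<^sup>+ x. ennreal (dist x x0 powr p) \<partial>\<mu>) < \<infinity>)}"

definition couplings :: "'a::metric_space measure \<Rightarrow> 'a measure \<Rightarrow> ('a \<times> 'a) measure set" where
  "couplings \<mu> \<nu> = {\<pi>. prob_space \<pi> \<and> sets \<pi> = sets (borel \<Otimes>\<^sub>M borel) \<and>
                        distr \<pi> borel fst = \<mu> \<and> distr \<pi> borel snd = \<nu>}"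

definition Wp :: "real \<Rightarrow> 'a::metric_space measure \<Rightarrow> 'a measure \<Rightarrow> real" where
  "Wp p \<mu> \<nu> = (enn2real (INF \<pi> \<in> couplings \<mu> \<nu>.
                   \<integral>\<^sup>+ z. ennreal (dist (fst z) (snd z) powr p) \<partial>\<pi>)) powr (1 / p)"

definition is_ray :: "real \<Rightarrow> (real \<Rightarrow> 'a::metric_space measure) \<Rightarrow> bool" where
  "is_ray p m \<longleftrightarrow> (\<forall>t\<ge>0. m t \<in> Pp p) \<and>
     (\<forall>s\<ge>0. \<forall>t\<ge>0. Wp p (m s) (m t) = \<bar>s - t\<bar> * Wp p (m 0) (m 1))"

definition unit_speed_ray :: "real \<Rightarrow> (real \<Rightarrow> 'a::metric_space measure) \<Rightarrow> bool" where
  "unit_speed_ray p m \<longleftrightarrow> is_ray p m \<and> Wp p (m 0) (m 1) = 1"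

definition geodesics_T :: "real \<Rightarrow> 'a::metric_space measure \<Rightarrow> 'a measure \<Rightarrow> (real \<Rightarrow> 'a measure) set" where
  "geodesics_T p \<mu> \<nu> = {c. (\<forall>t\<in>{0..Wp p \<mu> \<nu>}. c t \<in> Pp p) \<and> c 0 = \<mu> \<and> c (Wp p \<mu> \<nu>) = \<nu> \<and>
      (\<forall>s\<in>{0..Wp p \<mu> \<nu>}. \<forall>t\<in>{0..Wp p \<mu> \<nu>}. Wp p (c s) (c t) = \<bar>s - t\<bar>)}"

definition is_coray :: "real \<Rightarrow> (real \<Rightarrow> 'a::metric_space measure) \<Rightarrow> 'a measure \<Rightarrow> (real \<Rightarrow> 'a measure) \<Rightarrow> bool" where
  "is_coray p m \<nu>0 \<nu> \<longleftrightarrow> is_ray p \<nu> \<and> \<nu> 0 = \<nu>0 \<and>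
     (\<exists>s::nat \<Rightarrow> real. \<exists>lam::nat \<Rightarrow> 'a measure. \<exists>c::nat \<Rightarrow> real \<Rightarrow> 'a measure.
        filterlim s at_top sequentially \<and>
        (\<forall>n. lam n \<in> Pp p) \<and>
        (\<lambda>n. Wp p (lam n) \<nu>0) \<longlonglongrightarrow> 0 \<and>
        (\<forall>n. c n \<in> geodesics_T p (lam n) (m (s n))) \<and>
        (\<forall>t\<ge>0. (\<lambda>n. Wp p (c n t) (\<nu> t)) \<longlonglongrightarrow> 0))"

end

theory Submission
  imports Defs "HOL-Library.Diagonal_Subsequence"
begin

text \<open>For a fixed time \<open>t\<close> the measures \<open>\<nu>\<^sup>n\<^sub>t\<close> are precompact in \<open>W\<^sub>p\<close>: the space is proper
  (Hopf--Rinow), so it suffices that their \<open>p\<close>-th moments are uniformly integrable. Since \<open>p > 1\<close>,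
  equality in Minkowski's inequality forces an (almost) optimal plan along a geodesic of measures
  to split distances proportionally. On \<open>\<mu>\<^sub>0, \<mu>\<^sub>1, \<mu>\<^sub>s\<close> this bounds \<open>d(x\<^sub>0, x\<^sub>s) / s\<close> by
  \<open>2 d(x\<^sub>0, x\<^sub>1)\<close>, whose \<open>p\<close>-th power is uniformly integrable because \<open>\<mu>\<^sub>0\<close> and \<open>\<mu>\<^sub>1\<close> are fixed; hence
  so is \<open>d(x, o) / t\<^sub>n\<close> under \<open>\<mu>\<close> at time \<open>t\<^sub>n\<close>. On \<open>\<nu>\<^sup>n\<^sub>0, \<nu>\<^sup>n\<^sub>t, \<mu>\<close> it bounds \<open>d(x, y)\<close> by a multiple of
  \<open>t d(x, z) / L\<^sub>n\<close>, which transfers the integrability to \<open>\<nu>\<^sup>n\<^sub>t\<close>. A diagonal argument over rational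
  times and the isometry of the curves give convergence at all times, and the limit is a ray.\<close>

section \<open>The two-point energy and the excess function\<close>

text \<open>Over a proper space a \<open>Wp\<close>-bounded sequence need not be precompact: a
  vanishing mass far away can carry a fixed p-th moment. Boundedness gives tightness only, so the
  geodesic property must exclude this loss. The endpoints at time \<open>tn n\<close> run off to
  infinity and no fixed measure controls them; only after division by \<open>tn n\<close> are their
  tails uniformly small, and \<open>tn n\<close> is eventually at most twice the length of the
  second geodesic, so this normalisation fits there. Plans are optimal up to a slack, and glued
  plans have middle variables that agree up to a small distance; the slack is removed by an epsilon
  argument. Strict convexity must therefore be quantitative: a fixed relative loss of energy
  whenever the split is wrong by more than a factor 2. Any bounded factor would do, since it
  preserves uniform integrability. Compactness of measures is imported from the real line: an
  injective Borel code of points by reals moves the sequence there, and almost surely convergent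
  representatives are decoded afterwards.\<close>

lemma powr_gt_tangent:
  fixes p x :: real
  assumes "p > 1" "x \<ge> 0" "x \<noteq> 1"
  shows "1 + p * (x - 1) < x powr p"
proof (cases "x = 0")
  case True
  then show ?thesis using assms by simp
next
  case False
  have d: "((\<lambda>u. u powr p) has_real_derivative p * u powr (p - 1)) (at u)" if "u > 0" for u
    using that by (auto intro!: derivative_eq_intros)
  show ?thesis
  proof (cases "x < 1")
    case True
    have "\<exists>z>x. z < 1 \<and> 1 powr p - x powr p = (1 - x) * (p * z powr (p - 1))"
      using True False assms by (intro MVT2 d) auto
    then obtain z where z: "z > x" "z < 1" "1 powr p - x powr p = (1 - x) * (p * z powr (p - 1))"
      by auto
    have "z powr (p - 1) < 1"
      using powr_less_mono2[of "p - 1" z 1] z assms by auto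
    then have "(1 - x) * (p * z powr (p - 1)) < (1 - x) * (p * 1)"
      using True assms by (intro mult_strict_left_mono) auto
    with z show ?thesis by (simp add: algebra_simps)
  next
    case False
    then have x: "x > 1" using assms by simp
    have "\<exists>z>1. z < x \<and> x powr p - 1 powr p = (x - 1) * (p * z powr (p - 1))"
      using x by (intro MVT2 d) auto
    then obtain z where z: "z > 1" "z < x" "x powr p - 1 powr p = (x - 1) * (p * z powr (p - 1))"
      by auto
    have "z powr (p - 1) > 1"
      using z assms by (simp add: gr_one_powr)
    then have "(x - 1) * (p * z powr (p - 1)) > (x - 1) * (p * 1)"
      using x assms by (intro mult_strict_left_mono) auto
    with z show ?thesis by (simp add: algebra_simps)
  qed
qed

text \<open>For \<open>0 < l < 1\<close> this is
  \<open>l * (a / l) powr p + (1 - l) * (b / (1 - l)) powr p\<close>, so Jensen bounds it below by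
  \<open>(a + b) powr p\<close>, with equality exactly at \<open>a = l * (a + b)\<close>. It is
  linear in \<open>a powr p\<close> and \<open>b powr p\<close>, hence its integral is controlled by
  the two p-th moments alone.\<close>

definition split_energy :: "real \<Rightarrow> real \<Rightarrow> real \<Rightarrow> real \<Rightarrow> real" where
  "split_energy p l a b = a powr p * l powr (1 - p) + b powr p * (1 - l) powr (1 - p)"

lemma split_energy_unit_gt:
  assumes "p > 1" "0 < l" "l < 1" "0 \<le> \<theta>" "\<theta> \<le> 1" "\<theta> \<noteq> l"
  shows "1 < split_energy p l \<theta> (1 - \<theta>)"
proof -
  have eq: "u powr p * k powr (1 - p) = k * (u / k) powr p" if "k > 0" "u \<ge> 0" for k u
    using that by (simp add: powr_divide powr_diff)
  have 1: "l * (1 + p * (\<theta> / l - 1)) < l * (\<theta> / l) powr p"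
    using assms by (intro mult_strict_left_mono powr_gt_tangent) auto
  have 2: "(1 - l) * (1 + p * ((1 - \<theta>) / (1 - l) - 1)) < (1 - l) * ((1 - \<theta>) / (1 - l)) powr p"
    using assms by (intro mult_strict_left_mono powr_gt_tangent) auto
  \<comment> \<open>Under the weights \<open>l\<close> and \<open>1 - l\<close> the slopes of the
    two tangent bounds at 1 cancel, because the two shares add up to 1.\<close>
  have "l * (1 + p * (\<theta> / l - 1)) + (1 - l) * (1 + p * ((1 - \<theta>) / (1 - l) - 1)) = 1"
    using assms by (simp add: field_simps)
  with 1 2 have "1 < l * (\<theta> / l) powr p + (1 - l) * ((1 - \<theta>) / (1 - l)) powr p"
    by linarith
  then show ?thesis
    using assms by (simp add: split_energy_def eq)
qed

lemma split_energy_unit_ge: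
  assumes "p > 1" "0 < l" "l < 1" "0 \<le> \<theta>" "\<theta> \<le> 1"
  shows "1 \<le> split_energy p l \<theta> (1 - \<theta>)"
proof (cases "\<theta> = l")
  case True
  have "k powr p * k powr (1 - p) = k" if "k > 0" for k
    using that by (simp flip: powr_add)
  then show ?thesis using True assms by (simp add: split_energy_def)
qed (use split_energy_unit_gt[of p l \<theta>] assms in simp)

lemma split_energy_scale:
  assumes "a \<ge> 0" "b \<ge> 0" "a + b > 0"
  shows "split_energy p l a b =
    (a + b) powr p * split_energy p l (a / (a + b)) (1 - a / (a + b))"
proof -
  have e: "1 - a / (a + b) = b / (a + b)" using assms by (simp add: field_simps)
  have "(a + b) powr p \<noteq> 0" using assms by simp
  then show ?thesis
    unfolding split_energy_def e using assms by (simp add: powr_divide field_simps)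
qed

lemma powr_sum_le_split_energy:
  assumes "p > 1" "0 < l" "l < 1" "a \<ge> 0" "b \<ge> 0"
  shows "(a + b) powr p \<le> split_energy p l a b"
proof (cases "a + b > 0")
  case True
  have "(a + b) powr p * 1 \<le> split_energy p l a b"
    unfolding split_energy_scale[OF assms(4,5) True]
    using assms True by (intro mult_left_mono split_energy_unit_ge) auto
  then show ?thesis by simp
next
  case False
  then have "a = 0" "b = 0" using assms by auto
  then show ?thesis by (simp add: split_energy_def)
qed

text \<open>The proportions \<open>a / (a + b)\<close> outside the open interval from
  \<open>l/2\<close> to \<open>2*l\<close> form a compact set, on which the strict Jensen inequality
  has a positive minimal gap; homogeneity extends it to all \<open>a\<close> and \<open>b\<close>.
  The constant depends only on \<open>p\<close> and \<open>l\<close>.\<close>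

lemma split_energy_deficit:
  assumes "p > 1" "0 < l" "l < 1"
  obtains c where "c > 0"
    "\<And>a b. \<lbrakk>a \<ge> 0; b \<ge> 0; a < l * (a + b) / 2 \<or> a > 2 * l * (a + b)\<rbrakk>
       \<Longrightarrow> (1 + c) * (a + b) powr p \<le> split_energy p l a b"
proof -
  define K where "K = {0..1} \<inter> ({..l/2} \<union> {2*l..})"
  have K: "compact K" unfolding K_def by (intro compact_Int_closed closed_Un) auto
  \<comment> \<open>The point 0 keeps \<open>K\<close> nonempty even when
    \<open>2 * l > 1\<close>.\<close>
  have "0 \<in> K" using assms by (auto simp: K_def)
  then have "K \<noteq> {}" by auto
  have "continuous_on K (\<lambda>\<theta>. split_energy p l \<theta> (1 - \<theta>))"
    unfolding split_energy_def using assms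
    by (intro continuous_intros continuous_on_powr') (auto simp: K_def)
  from continuous_attains_inf[OF K \<open>K \<noteq> {}\<close> this] obtain \<theta>0 where
    t0: "\<theta>0 \<in> K" "\<And>\<theta>. \<theta> \<in> K \<Longrightarrow> split_energy p l \<theta>0 (1 - \<theta>0) \<le> split_energy p l \<theta> (1 - \<theta>)"
    by blast
  define c where "c = split_energy p l \<theta>0 (1 - \<theta>0) - 1"
  have "c > 0"
    using split_energy_unit_gt[of p l \<theta>0] t0(1) assms by (auto simp: c_def K_def)
  moreover have "(1 + c) * (a + b) powr p \<le> split_energy p l a b"
    if "a \<ge> 0" "b \<ge> 0" "a < l * (a + b) / 2 \<or> a > 2 * l * (a + b)" for a b
  proof (cases "a + b > 0")
    case True
    have "a / (a + b) \<in> K"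
      using that assms True by (auto simp: K_def field_simps)
    from t0(2)[OF this] have "(a + b) powr p * (1 + c) \<le> split_energy p l a b"
      unfolding split_energy_scale[OF that(1,2) True] c_def
      by (intro mult_left_mono) auto
    then show ?thesis by (simp add: mult.commute)
  next
    case False
    then have "a = 0" "b = 0" using that by auto
    then show ?thesis using that by simp
  qed
  ultimately show ?thesis using that by blast
qed

text \<open>Jensen is an equality when the weight is proportional to the sizes. Used with norms in
  place of pointwise values, this gives the sharp constant in Minkowski's inequality.\<close>

lemma split_energy_optimal:
  assumes "A > 0" "B > 0"
  shows "split_energy p (A / (A + B)) A B = (A + B) powr p"
proof -
  have e: "1 - A / (A + B) = B / (A + B)" using assms by (simp add: field_simps)
  have k: "k powr p * k powr (1 - p) = k" if "k > 0" for k :: real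
    using that by (simp flip: powr_add)
  have k': "k powr p * (k / (A + B)) powr (1 - p) = k * (A + B) powr (p - 1)" if "k > 0" for k
  proof -
    have "k powr p * (k / (A + B)) powr (1 - p) = (k powr p * k powr (1 - p)) / (A + B) powr (1 - p)"
      using that assms by (simp add: powr_divide)
    also have "\<dots> = k * (A + B) powr (p - 1)"
      unfolding k[OF that] by (metis divide_inverse minus_diff_eq powr_minus)
    finally show ?thesis .
  qed
  have "split_energy p (A / (A + B)) A B = (A + B) * (A + B) powr (p - 1)"
    unfolding split_energy_def e k'[OF assms(1)] k'[OF assms(2)] by (simp add: algebra_simps)
  also have "\<dots> = (A + B) powr p"
    using assms by (simp add: powr_diff)
  finally show ?thesis .
qed

text \<open>A continuous replacement for cutting off \<open>u powr p\<close> at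
  \<open>u > R\<close>. It is jointly homogeneous in \<open>R\<close> and \<open>u\<close> and,
  unlike a cut-off by an indicator, subadditive up to \<open>2 powr p\<close> with thresholds that
  add, so tail bounds follow the triangle inequality. Continuity carries it through almost sure
  limits.\<close>

definition excess :: "real \<Rightarrow> real \<Rightarrow> real \<Rightarrow> real" where
  "excess p R u = max 0 (u - R) powr p"

lemma excess_nonneg [simp]: "excess p R u \<ge> 0"
  by (simp add: excess_def)

lemma excess_measurable [measurable]: "excess p R \<in> borel_measurable borel"
  unfolding excess_def by measurable

lemma powr_add_le: 
  fixes u v p :: real
  assumes "p \<ge> 0" "u \<ge> 0" "v \<ge> 0"
  shows "(u + v) powr p \<le> 2 powr p * (u powr p + v powr p)"
proof -
  have "(u + v) powr p \<le> (2 * max u v) powr p"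
    using assms by (intro powr_mono2) auto
  also have "\<dots> = 2 powr p * max u v powr p"
    using assms by (simp add: powr_mult)
  also have "max u v powr p \<le> u powr p + v powr p" by (auto simp: max_def)
  finally show ?thesis by simp
qed

lemma excess_mono:
  assumes "p \<ge> 0" "u \<le> v" "S \<le> R"
  shows "excess p R u \<le> excess p S v"
  unfolding excess_def using assms by (intro powr_mono2) auto

lemma excess_le_powr:
  assumes "p \<ge> 0" "R \<ge> 0" "u \<ge> 0"
  shows "excess p R u \<le> u powr p"
  unfolding excess_def using assms by (intro powr_mono2) auto

lemma excess_scale:
  assumes "c \<ge> 0" 
  shows "excess p (c * R) (c * u) = c powr p * excess p R u"
proof -
  have "max 0 (c * u - c * R) = c * max 0 (u - R)"
    using max_mult_distrib_left[of c 0 "u - R"] assms by (simp add: right_diff_distrib)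
  then show ?thesis using assms by (simp add: excess_def powr_mult)
qed

lemma excess_add:
  assumes "p \<ge> 0"
  shows "excess p (R + S) (u + v) \<le> 2 powr p * (excess p R u + excess p S v)"
proof -
  have "excess p (R + S) (u + v) \<le> (max 0 (u - R) + max 0 (v - S)) powr p"
    unfolding excess_def using assms by (intro powr_mono2) auto
  also have "\<dots> \<le> 2 powr p * (excess p R u + excess p S v)"
    unfolding excess_def using assms by (intro powr_add_le) auto
  finally show ?thesis .
qed

section \<open>Approximate gluing\<close>

text \<open>The distance is below \<open>r\<close> iff some dense point \<open>d\<close> and
  rational \<open>q\<close> satisfy \<open>dist (f x) d < q\<close> and
  \<open>dist d (g x) < r - q\<close>. This countable union only involves distances to fixed points;
  separability enters as a hypothesis, not through the type class.\<close>

lemma borel_measurable_dist_separable: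
  fixes f g :: "'b \<Rightarrow> 'a::metric_space"
  assumes sep: "separable_space TYPE('a)"
    and f: "f \<in> borel_measurable M" and g: "g \<in> borel_measurable M"
  shows "(\<lambda>x. dist (f x) (g x)) \<in> borel_measurable M"
proof (rule borel_measurableI_less)
  fix r :: real
  obtain D :: "'a set" where D: "countable D" "closure D = UNIV"
    using sep unfolding separable_space_def by auto
  have fd: "(\<lambda>x. dist (f x) d) \<in> borel_measurable M" for d
    by (rule measurable_compose[OF f borel_measurable_continuous_onI]) (intro continuous_intros)
  have gd: "(\<lambda>x. dist d (g x)) \<in> borel_measurable M" for d
    by (rule measurable_compose[OF g borel_measurable_continuous_onI]) (intro continuous_intros)
  have "{x \<in> space M. dist (f x) (g x) < r} =
    (\<Union>d\<in>D. \<Union>q\<in>\<rat>. {x \<in> space M. dist (f x) d < q \<and> dist d (g x) < r - q})" (is "?L = ?R")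
  proof
    show "?R \<subseteq> ?L"
      using dist_triangle_less_add by (force simp: dist_commute intro: dist_triangle_lt)
    show "?L \<subseteq> ?R"
    proof
      fix x assume x: "x \<in> ?L"
      define e where "e = (r - dist (f x) (g x)) / 2"
      have "e > 0" using x by (simp add: e_def)
      then obtain d where d: "d \<in> D" "dist d (f x) < e"
        using D(2) closure_approachable[of "f x" D] by auto
      have "dist (f x) d < r - dist d (g x)"
        using d(2) dist_triangle[of d "g x" "f x"] by (simp add: e_def dist_commute field_simps)
      then obtain q where "q \<in> \<rat>" "dist (f x) d < q" "q < r - dist d (g x)"
        using Rats_dense_in_real by blast
      then show "x \<in> ?R" using x d by (auto intro!: bexI[of _ d] bexI[of _ q])
    qed
  qed
  also have "\<dots> \<in> sets M"
    using D(1) countable_rat fd gd by (intro sets.countable_UN'') auto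
  finally show "?L \<in> sets M" .
qed

text \<open>\<open>q\<close> picks the first point of a dense sequence within \<open>e / 2\<close>,
  so its fibres form a countable Borel partition into small sets.\<close>

lemma quantizer_exists:
  assumes sep: "separable_space TYPE('a::metric_space)" and "e > 0"
  obtains q :: "'a::metric_space \<Rightarrow> nat" where "q \<in> measurable borel (count_space UNIV)"
    "\<And>x y. q x = q y \<Longrightarrow> dist x y < e"
proof -
  obtain D :: "'a set" where D: "countable D" "closure D = UNIV"
    using sep unfolding separable_space_def by auto
  have "D \<noteq> {}" using D(2) by auto
  define d where "d = from_nat_into D"
  have cover: "\<exists>i. dist x (d i) < e / 2" for x
  proof -
    obtain y where "y \<in> D" "dist y x < e / 2"
      using D(2) closure_approachable[of x D] \<open>e > 0\<close> by (metis UNIV_I half_gt_zero)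
    then show ?thesis
      using from_nat_into_surj[OF D(1) \<open>y \<in> D\<close>] by (auto simp: d_def dist_commute)
  qed
  define q where "q x = (LEAST i. dist x (d i) < e / 2)" for x
  have q: "dist x (d (q x)) < e / 2" for x
    unfolding q_def using cover[of x] by (rule LeastI_ex)
  have "q \<in> measurable borel (count_space UNIV)"
    unfolding q_def
  proof (rule measurable_Least)
    fix i
    have [measurable]: "(\<lambda>x. dist x (d i)) \<in> borel_measurable borel"
      by (intro borel_measurable_continuous_onI continuous_intros)
    show "Measurable.pred borel (\<lambda>x. dist x (d i) < e / 2)"
      by measurable
  qed
  moreover have "dist x y < e" if "q x = q y" for x y
    using q[of x] q[of y] dist_triangle2[of x y "d (q x)"] that by simp
  ultimately show ?thesis using that by blast
qed

text \<open>Conditioning both factors on the cell of a fine countable partition that contains the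
  common marginal replaces the disintegration of the exact gluing lemma.\<close>

lemma approx_gluing:
  fixes f :: "'b \<Rightarrow> 'a::metric_space" and g :: "'c \<Rightarrow> 'a"
  assumes sep: "separable_space TYPE('a)"
    and P: "prob_space P" and Q: "prob_space Q"
    and f[measurable]: "f \<in> borel_measurable P" and g[measurable]: "g \<in> borel_measurable Q"
    and eq: "distr P borel f = distr Q borel g" and "e > 0"
  obtains M where "prob_space M" "sets M = sets (P \<Otimes>\<^sub>M Q)" "distr M P fst = P" "distr M Q snd = Q"
    "AE z in M. dist (f (fst z)) (g (snd z)) < e"
proof -
  interpret P: prob_space P by fact
  interpret Q: prob_space Q by fact
  interpret PQ: pair_prob_space P Q ..
  obtain q :: "'a \<Rightarrow> nat" where q[measurable]: "q \<in> measurable borel (count_space UNIV)"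
    and q_small: "\<And>x y. q x = q y \<Longrightarrow> dist x y < e"
    using quantizer_exists[OF sep \<open>e > 0\<close>] by blast
  define c where "c i = emeasure P {x \<in> space P. q (f x) = i}" for i
  have c': "c i = emeasure Q {y \<in> space Q. q (g y) = i}" for i
  proof -
    have [measurable]: "q -` {i} \<in> sets borel"
      using measurable_sets[OF q, of "{i}"] by simp
    have "c i = emeasure (distr P borel f) (q -` {i} \<inter> space borel)"
      by (subst emeasure_distr) (auto simp: c_def intro!: arg_cong[where f="emeasure P"])
    also have "\<dots> = emeasure Q {y \<in> space Q. q (g y) = i}"
      unfolding eq by (subst emeasure_distr) (auto intro!: arg_cong[where f="emeasure Q"])
    finally show ?thesis .
  qed
  have c_fin: "c i \<noteq> \<infinity>" for i by (simp add: c_def)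
  \<comment> \<open>Given the common cell \<open>i\<close>, the two factors are made independent.
    The diagonal block has product mass \<open>c i * c i\<close> and must carry mass
    \<open>c i\<close>, hence the density \<open>inverse (c i)\<close>. It is infinite on cells of
    mass 0, which are null for both factors.\<close>
  define w where "w z = (if q (f (fst z)) = q (g (snd z)) then inverse (c (q (f (fst z)))) else 0)" for z
  have w[measurable]: "w \<in> borel_measurable (P \<Otimes>\<^sub>M Q)"
  proof -
    have [measurable]: "(\<lambda>z. q (f (fst z))) \<in> measurable (P \<Otimes>\<^sub>M Q) (count_space UNIV)"
      "(\<lambda>z. q (g (snd z))) \<in> measurable (P \<Otimes>\<^sub>M Q) (count_space UNIV)"
      by measurable
    have [measurable]: "(\<lambda>z. inverse (c (q (f (fst z))))) \<in> borel_measurable (P \<Otimes>\<^sub>M Q)"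
      by (rule measurable_compose[of "\<lambda>z. q (f (fst z))" _ "count_space UNIV"]) simp_all
    \<comment> \<open>Equality of the two indices is expanded into a countable disjunction over
      their common value.\<close>
    have "Measurable.pred (P \<Otimes>\<^sub>M Q) (\<lambda>z. \<exists>i. q (g (snd z)) = i \<and> q (f (fst z)) = i)"
      by measurable
    then have [measurable]: "Measurable.pred (P \<Otimes>\<^sub>M Q) (\<lambda>z. q (f (fst z)) = q (g (snd z)))"
      by simp
    show ?thesis unfolding w_def by measurable
  qed
  have nonnullP: "AE x in P. c (q (f x)) \<noteq> 0"
  proof -
    have "AE x in P. \<forall>i. c i = 0 \<longrightarrow> q (f x) \<noteq> i"
      unfolding AE_all_countable
    proof
      fix i show "AE x in P. c i = 0 \<longrightarrow> q (f x) \<noteq> i"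
      proof (cases "c i = 0")
        case True
        then have "{x \<in> space P. q (f x) = i} \<in> null_sets P"
          unfolding c_def by (intro null_setsI) auto
        then show ?thesis by (rule AE_I') auto
      qed simp
    qed
    then show ?thesis by eventually_elim auto
  qed
  have nonnullQ: "AE y in Q. c (q (g y)) \<noteq> 0"
  proof -
    have "AE y in Q. \<forall>i. c i = 0 \<longrightarrow> q (g y) \<noteq> i"
      unfolding AE_all_countable
    proof
      fix i show "AE y in Q. c i = 0 \<longrightarrow> q (g y) \<noteq> i"
      proof (cases "c i = 0")
        case True
        then have "{y \<in> space Q. q (g y) = i} \<in> null_sets Q"
          unfolding c' by (intro null_setsI) auto
        then show ?thesis by (rule AE_I') auto
      qed simp
    qed
    then show ?thesis by eventually_elim auto
  qed
  have inv: "inverse (c i) * c i = 1" if "c i \<noteq> 0" for i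
  proof -
    have "c i / c i = 1" using that c_fin[of i] by (intro ennreal_divide_self) (auto simp: less_top)
    then show ?thesis by (simp add: divide_ennreal_def mult.commute)
  qed
  have intQ: "(\<integral>\<^sup>+ y. w (x, y) \<partial>Q) = 1" if "c (q (f x)) \<noteq> 0" "x \<in> space P" for x
  proof -
    have "(\<integral>\<^sup>+ y. w (x, y) \<partial>Q) =
      (\<integral>\<^sup>+ y. inverse (c (q (f x))) * indicator {y \<in> space Q. q (g y) = q (f x)} y \<partial>Q)"
      by (intro nn_integral_cong) (auto simp: w_def indicator_def)
    also have "\<dots> = 1"
      by (subst nn_integral_cmult_indicator) (auto simp: inv that simp flip: c')
    finally show ?thesis .
  qed
  have intP: "(\<integral>\<^sup>+ x. w (x, y) \<partial>P) = 1" if "c (q (g y)) \<noteq> 0" "y \<in> space Q" for y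
  proof -
    have "(\<integral>\<^sup>+ x. w (x, y) \<partial>P) =
      (\<integral>\<^sup>+ x. inverse (c (q (g y))) * indicator {x \<in> space P. q (f x) = q (g y)} x \<partial>P)"
      by (intro nn_integral_cong) (auto simp: w_def indicator_def)
    also have "\<dots> = 1"
      by (subst nn_integral_cmult_indicator) (auto simp: inv that simp flip: c_def)
    finally show ?thesis .
  qed
  define M where "M = density (P \<Otimes>\<^sub>M Q) w"
  have sM: "sets M = sets (P \<Otimes>\<^sub>M Q)" by (simp add: M_def)
  have [measurable]: "fst \<in> measurable M P" "snd \<in> measurable M Q"
    by (simp_all add: M_def)
  have dP: "distr M P fst = P"
  proof (rule measure_eqI)
    fix A assume A[measurable]: "A \<in> sets (distr M P fst)"
    then have [measurable]: "A \<in> sets P" by simp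
    have "emeasure (distr M P fst) A = (\<integral>\<^sup>+ z. w z * indicator A (fst z) \<partial>(P \<Otimes>\<^sub>M Q))"
      by (subst emeasure_distr) (auto simp: M_def emeasure_density space_pair_measure
          intro!: nn_integral_cong split: split_indicator)
    also have "\<dots> = (\<integral>\<^sup>+ x. (\<integral>\<^sup>+ y. w (x, y) * indicator A x \<partial>Q) \<partial>P)"
      by (subst Q.nn_integral_fst[symmetric]) auto
    also have "\<dots> = (\<integral>\<^sup>+ x. indicator A x \<partial>P)"
    proof (rule nn_integral_cong_AE)
      show "AE x in P. (\<integral>\<^sup>+ y. w (x, y) * indicator A x \<partial>Q) = indicator A x"
        using nonnullP AE_space[of P]
      proof eventually_elim
        case (elim x)
        have "(\<integral>\<^sup>+ y. w (x, y) * indicator A x \<partial>Q) = (\<integral>\<^sup>+ y. w (x, y) \<partial>Q) * indicator A x"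
          using elim by (intro nn_integral_multc) measurable
        then show ?case by (simp add: intQ elim)
      qed
    qed
    also have "\<dots> = emeasure P A" by simp
    finally show "emeasure (distr M P fst) A = emeasure P A" .
  qed simp
  have dQ: "distr M Q snd = Q"
  proof (rule measure_eqI)
    fix A assume A[measurable]: "A \<in> sets (distr M Q snd)"
    then have [measurable]: "A \<in> sets Q" by simp
    have "emeasure (distr M Q snd) A = (\<integral>\<^sup>+ z. w z * indicator A (snd z) \<partial>(P \<Otimes>\<^sub>M Q))"
      by (subst emeasure_distr) (auto simp: M_def emeasure_density space_pair_measure
          intro!: nn_integral_cong split: split_indicator)
    also have "\<dots> = (\<integral>\<^sup>+ y. (\<integral>\<^sup>+ x. w (x, y) * indicator A y \<partial>P) \<partial>Q)"
      by (subst PQ.nn_integral_snd[symmetric]) auto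
    also have "\<dots> = (\<integral>\<^sup>+ y. indicator A y \<partial>Q)"
    proof (rule nn_integral_cong_AE)
      show "AE y in Q. (\<integral>\<^sup>+ x. w (x, y) * indicator A y \<partial>P) = indicator A y"
        using nonnullQ AE_space[of Q]
      proof eventually_elim
        case (elim y)
        have "(\<integral>\<^sup>+ x. w (x, y) * indicator A y \<partial>P) = (\<integral>\<^sup>+ x. w (x, y) \<partial>P) * indicator A y"
          using elim by (intro nn_integral_multc) measurable
        then show ?case by (simp add: intP elim)
      qed
    qed
    also have "\<dots> = emeasure Q A" by simp
    finally show "emeasure (distr M Q snd) A = emeasure Q A" .
  qed simp
  have "prob_space M"
  proof
    have "emeasure M (space M) = emeasure (distr M P fst) (space P)"
      by (subst emeasure_distr) (auto simp: M_def space_pair_measure intro!: arg_cong[where f="emeasure _"])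
    then show "emeasure M (space M) = 1" by (simp add: dP P.emeasure_space_1)
  qed
  moreover have "AE z in M. dist (f (fst z)) (g (snd z)) < e"
    unfolding M_def AE_density[OF w]
    by (auto simp: w_def q_small)
  ultimately show ?thesis using that sM dP dQ by blast
qed

section \<open>The Wasserstein pseudometric\<close>

text \<open>Random-variable form of marginals: couplings become pairs of maps on an arbitrary
  probability space, so a glued plan can be used directly without being pushed to a threefold
  product.\<close>

definition has_law :: "'b measure \<Rightarrow> ('b \<Rightarrow> 'a::metric_space) \<Rightarrow> 'a measure \<Rightarrow> bool" where
  "has_law M X \<mu> \<longleftrightarrow> X \<in> borel_measurable M \<and> distr M borel X = \<mu>"

lemma has_law_measurable: "has_law M X \<mu> \<Longrightarrow> X \<in> borel_measurable M"
  by (simp add: has_law_def)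

lemma nn_integral_has_law:
  assumes "has_law M X \<mu>" "f \<in> borel_measurable borel"
  shows "(\<integral>\<^sup>+ x. f x \<partial>\<mu>) = (\<integral>\<^sup>+ \<omega>. f (X \<omega>) \<partial>M)"
  using assms by (auto simp: has_law_def nn_integral_distr)

lemma has_law_compose:
  assumes "has_law M X \<mu>" "T \<in> measurable N M" "distr N M T = M"
  shows "has_law N (\<lambda>\<omega>. X (T \<omega>)) \<mu>"
proof -
  have "distr N borel (X \<circ> T) = distr (distr N M T) borel X"
    using assms by (intro distr_distr[symmetric]) (auto simp: has_law_def)
  then show ?thesis using assms by (auto simp: has_law_def comp_def)
qed

lemma couplings_has_law:
  assumes "\<pi> \<in> couplings \<mu> \<nu>"
  shows "has_law \<pi> fst \<mu>" "has_law \<pi> snd \<nu>"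
proof -
  have s: "sets \<pi> = sets (borel \<Otimes>\<^sub>M borel)" using assms by (simp add: couplings_def)
  have "fst \<in> measurable \<pi> borel" "snd \<in> measurable \<pi> borel"
    using measurable_cong_sets[OF s refl] measurable_fst measurable_snd by blast+
  then show "has_law \<pi> fst \<mu>" "has_law \<pi> snd \<nu>"
    using assms by (simp_all add: couplings_def has_law_def)
qed

lemma has_law_coupling:
  assumes "prob_space M" "has_law M X \<mu>" "has_law M Y \<nu>"
  shows "distr M (borel \<Otimes>\<^sub>M borel) (\<lambda>\<omega>. (X \<omega>, Y \<omega>)) \<in> couplings \<mu> \<nu>"
proof -
  have [measurable]: "X \<in> borel_measurable M" "Y \<in> borel_measurable M"
    using assms by (auto simp: has_law_def)
  interpret prob_space M by fact
  show ?thesis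
    using assms by (auto simp: couplings_def has_law_def distr_distr comp_def intro!: prob_space_distr)
qed

lemma Wp_nonneg [simp]: "Wp p \<mu> \<nu> \<ge> 0"
  by (simp add: Wp_def)

lemma Wp_powr:
  "p > 0 \<Longrightarrow> Wp p \<mu> \<nu> powr p =
    enn2real (INF \<pi> \<in> couplings \<mu> \<nu>. \<integral>\<^sup>+ z. ennreal (dist (fst z) (snd z) powr p) \<partial>\<pi>)"
  by (simp add: Wp_def powr_powr)

lemma Wp_powr_le:
  fixes X Y :: "'b \<Rightarrow> 'a::metric_space"
  assumes sep: "separable_space TYPE('a)" and "p > 0"
    and "prob_space M" "has_law M X \<mu>" "has_law M Y \<nu>"
  shows "ennreal (Wp p \<mu> \<nu> powr p) \<le> (\<integral>\<^sup>+ \<omega>. ennreal (dist (X \<omega>) (Y \<omega>) powr p) \<partial>M)"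
proof -
  let ?\<pi> = "distr M (borel \<Otimes>\<^sub>M borel) (\<lambda>\<omega>. (X \<omega>, Y \<omega>))"
  let ?c = "\<lambda>\<pi>. \<integral>\<^sup>+ z. ennreal (dist (fst z) (snd z) powr p) \<partial>\<pi>"
  let ?I = "INF \<pi> \<in> couplings \<mu> \<nu>. ?c \<pi>"
  have [measurable]: "X \<in> borel_measurable M" "Y \<in> borel_measurable M"
    using assms by (auto simp: has_law_def)
  have [measurable]: "(\<lambda>z. dist (fst z) (snd z)) \<in> borel_measurable (borel \<Otimes>\<^sub>M borel :: ('a \<times> 'a) measure)"
    by (intro borel_measurable_dist_separable[OF sep]) measurable
  \<comment> \<open>\<open>enn2real\<close> sends infinity to 0, so this inequality is valid whether
    or not the infimum is finite.\<close>
  have "ennreal (Wp p \<mu> \<nu> powr p) \<le> ?I"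
    unfolding Wp_powr[OF \<open>p > 0\<close>] by (simp add: ennreal_enn2real_if)
  also have "?I \<le> ?c ?\<pi>"
    using assms by (intro INF_lower has_law_coupling)
  also have "\<dots> = (\<integral>\<^sup>+ \<omega>. ennreal (dist (X \<omega>) (Y \<omega>) powr p) \<partial>M)"
    by (subst nn_integral_distr) auto
  finally show ?thesis .
qed

lemma Wp_leI:
  fixes X Y :: "'b \<Rightarrow> 'a::metric_space"
  assumes sep: "separable_space TYPE('a)" and "p > 0"
    and "prob_space M" "has_law M X \<mu>" "has_law M Y \<nu>"
    and "A \<ge> 0" "(\<integral>\<^sup>+ \<omega>. ennreal (dist (X \<omega>) (Y \<omega>) powr p) \<partial>M) \<le> ennreal (A powr p)"
  shows "Wp p \<mu> \<nu> \<le> A"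
proof -
  have "ennreal (Wp p \<mu> \<nu> powr p) \<le> ennreal (A powr p)"
    using Wp_powr_le[OF assms(1-5)] assms(7) by (rule order_trans)
  then have "Wp p \<mu> \<nu> powr p \<le> A powr p" by (simp add: ennreal_le_iff)
  then show ?thesis using powr_less_mono2[of p A "Wp p \<mu> \<nu>"] assms by force
qed

lemma Pp_moment_finite:
  assumes "\<mu> \<in> Pp p" "p > 0"
  shows "(\<integral>\<^sup>+ x. ennreal (dist x z powr p) \<partial>\<mu>) < \<infinity>"
proof -
  obtain x0 where x0: "prob_space \<mu>" "sets \<mu> = sets borel" "(\<integral>\<^sup>+ x. ennreal (dist x x0 powr p) \<partial>\<mu>) < \<infinity>"
    using assms by (auto simp: Pp_def)
  interpret prob_space \<mu> by fact
  have [measurable]: "(\<lambda>x. dist x x0) \<in> borel_measurable \<mu>"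
    unfolding measurable_cong_sets[OF x0(2) refl] by (intro borel_measurable_continuous_onI continuous_intros)
  have "(\<integral>\<^sup>+ x. ennreal (dist x z powr p) \<partial>\<mu>) \<le>
    (\<integral>\<^sup>+ x. ennreal (2 powr p) * (ennreal (dist x x0 powr p) + ennreal (dist x0 z powr p)) \<partial>\<mu>)"
  proof (rule nn_integral_mono)
    fix x
    have "dist x z powr p \<le> (dist x x0 + dist x0 z) powr p"
      using assms by (intro powr_mono2 dist_triangle) auto
    also have "\<dots> \<le> 2 powr p * (dist x x0 powr p + dist x0 z powr p)"
      using assms by (intro powr_add_le) auto
    finally show "ennreal (dist x z powr p) \<le> ennreal (2 powr p) * (ennreal (dist x x0 powr p) + ennreal (dist x0 z powr p))"
      by (simp flip: ennreal_plus ennreal_mult add: ennreal_leI)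
  qed
  also have "\<dots> = ennreal (2 powr p) * ((\<integral>\<^sup>+ x. ennreal (dist x x0 powr p) \<partial>\<mu>) + ennreal (dist x0 z powr p))"
    by (simp add: nn_integral_cmult nn_integral_add emeasure_space_1)
  also have "\<dots> < \<infinity>" using x0 by (simp add: ennreal_mult_less_top less_top)
  finally show ?thesis .
qed

text \<open>The product measure is a coupling of finite cost. This rules out an infinite infimum,
  which \<open>enn2real\<close> would turn into the value 0 of \<open>Wp\<close>.\<close>

lemma Pp_coupling_finite:
  fixes \<mu> \<nu> :: "'a::metric_space measure"
  assumes sep: "separable_space TYPE('a)" and "\<mu> \<in> Pp p" "\<nu> \<in> Pp p" "p > 0"
  shows "(INF \<pi> \<in> couplings \<mu> \<nu>. \<integral>\<^sup>+ z. ennreal (dist (fst z) (snd z) powr p) \<partial>\<pi>) < \<infinity>"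
proof -
  fix z :: 'a
  have s: "prob_space \<mu>" "prob_space \<nu>" and sets: "sets \<mu> = sets borel" "sets \<nu> = sets borel"
    using assms by (auto simp: Pp_def)
  interpret A: prob_space \<mu> by fact
  interpret B: prob_space \<nu> by fact
  interpret AB: pair_prob_space \<mu> \<nu> ..
  have [measurable]: "fst \<in> measurable (\<mu> \<Otimes>\<^sub>M \<nu>) borel" "snd \<in> measurable (\<mu> \<Otimes>\<^sub>M \<nu>) borel"
    using measurable_fst[of \<mu> \<nu>] measurable_snd[of \<mu> \<nu>]
    by (simp_all cong: measurable_cong_sets add: sets)
  have [measurable]: "(\<lambda>x. dist x z) \<in> borel_measurable borel"
    by (intro borel_measurable_continuous_onI continuous_intros)
  have dA: "distr (\<mu> \<Otimes>\<^sub>M \<nu>) borel fst = \<mu>"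
  proof (rule measure_eqI)
    fix S assume "S \<in> sets (distr (\<mu> \<Otimes>\<^sub>M \<nu>) borel fst)"
    then have S: "S \<in> sets \<mu>" by (simp add: sets)
    have "emeasure (distr (\<mu> \<Otimes>\<^sub>M \<nu>) borel fst) S = emeasure (\<mu> \<Otimes>\<^sub>M \<nu>) (S \<times> space \<nu>)"
      using S sets.sets_into_space[OF S]
      by (subst emeasure_distr) (auto simp: space_pair_measure sets intro!: arg_cong[where f="emeasure _"])
    also have "\<dots> = emeasure \<mu> S" using S by (simp add: B.emeasure_pair_measure_Times B.emeasure_space_1)
    finally show "emeasure (distr (\<mu> \<Otimes>\<^sub>M \<nu>) borel fst) S = emeasure \<mu> S" .
  qed (simp add: sets)
  have dB: "distr (\<mu> \<Otimes>\<^sub>M \<nu>) borel snd = \<nu>"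
  proof (rule measure_eqI)
    fix S assume "S \<in> sets (distr (\<mu> \<Otimes>\<^sub>M \<nu>) borel snd)"
    then have S: "S \<in> sets \<nu>" by (simp add: sets)
    have "emeasure (distr (\<mu> \<Otimes>\<^sub>M \<nu>) borel snd) S = emeasure (\<mu> \<Otimes>\<^sub>M \<nu>) (space \<mu> \<times> S)"
      using S sets.sets_into_space[OF S]
      by (subst emeasure_distr) (auto simp: space_pair_measure sets intro!: arg_cong[where f="emeasure _"])
    also have "\<dots> = emeasure \<nu> S" using S by (simp add: B.emeasure_pair_measure_Times A.emeasure_space_1)
    finally show "emeasure (distr (\<mu> \<Otimes>\<^sub>M \<nu>) borel snd) S = emeasure \<nu> S" .
  qed (simp add: sets)
  have laws: "has_law (\<mu> \<Otimes>\<^sub>M \<nu>) fst \<mu>" "has_law (\<mu> \<Otimes>\<^sub>M \<nu>) snd \<nu>"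
    using dA dB by (auto simp: has_law_def)
  let ?c = "\<lambda>\<pi>. \<integral>\<^sup>+ z. ennreal (dist (fst z) (snd z) powr p) \<partial>\<pi>"
  have [measurable]: "(\<lambda>z. dist (fst z) (snd z)) \<in> borel_measurable (borel \<Otimes>\<^sub>M borel :: ('a \<times> 'a) measure)"
    by (intro borel_measurable_dist_separable[OF sep]) measurable
  have "(INF \<pi> \<in> couplings \<mu> \<nu>. ?c \<pi>) \<le> ?c (distr (\<mu> \<Otimes>\<^sub>M \<nu>) (borel \<Otimes>\<^sub>M borel) (\<lambda>\<omega>. (fst \<omega>, snd \<omega>)))"
    by (intro INF_lower has_law_coupling laws) unfold_locales
  also have "\<dots> = (\<integral>\<^sup>+ \<omega>. ennreal (dist (fst (fst \<omega>, snd \<omega>)) (snd (fst \<omega>, snd \<omega>)) powr p) \<partial>(\<mu> \<Otimes>\<^sub>M \<nu>))"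
    by (rule nn_integral_distr[OF measurable_Pair]) measurable
  also have "\<dots> = ?c (\<mu> \<Otimes>\<^sub>M \<nu>)"
    by simp
  also have "\<dots> \<le> (\<integral>\<^sup>+ \<omega>. ennreal (2 powr p) * (ennreal (dist (fst \<omega>) z powr p) + ennreal (dist (snd \<omega>) z powr p)) \<partial>(\<mu> \<Otimes>\<^sub>M \<nu>))"
  proof (rule nn_integral_mono)
    fix \<omega> :: "'a \<times> 'a"
    have "dist (fst \<omega>) (snd \<omega>) powr p \<le> (dist (fst \<omega>) z + dist (snd \<omega>) z) powr p"
      using assms by (intro powr_mono2 dist_triangle2) auto
    also have "\<dots> \<le> 2 powr p * (dist (fst \<omega>) z powr p + dist (snd \<omega>) z powr p)"
      using assms by (intro powr_add_le) auto
    finally show "ennreal (dist (fst \<omega>) (snd \<omega>) powr p) \<le> ennreal (2 powr p) * (ennreal (dist (fst \<omega>) z powr p) + ennreal (dist (snd \<omega>) z powr p))"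
      by (simp flip: ennreal_plus ennreal_mult add: ennreal_leI)
  qed
  also have "\<dots> = ennreal (2 powr p) * ((\<integral>\<^sup>+ x. ennreal (dist x z powr p) \<partial>\<mu>) + (\<integral>\<^sup>+ x. ennreal (dist x z powr p) \<partial>\<nu>))"
    by (simp add: nn_integral_cmult nn_integral_add nn_integral_has_law[OF laws(1)] nn_integral_has_law[OF laws(2)])
  also have "\<dots> < \<infinity>"
    using Pp_moment_finite assms by (auto simp: ennreal_mult_less_top less_top)
  finally show ?thesis .
qed

text \<open>Finiteness of the infimum makes \<open>Wp\<close> its true p-th root, so a strict upper
  bound is realised by some plan. The strict gap is the slack that later arguments send to
  0.\<close>

lemma near_optimal_coupling:
  fixes \<mu> \<nu> :: "'a::metric_space measure"
  assumes sep: "separable_space TYPE('a)" and "\<mu> \<in> Pp p" "\<nu> \<in> Pp p" "p > 0" "Wp p \<mu> \<nu> < A"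
  obtains \<pi> where "prob_space \<pi>" "has_law \<pi> fst \<mu>" "has_law \<pi> snd \<nu>"
    "(\<integral>\<^sup>+ z. ennreal (dist (fst z) (snd z) powr p) \<partial>\<pi>) \<le> ennreal (A powr p)"
proof -
  let ?c = "\<lambda>\<pi>. \<integral>\<^sup>+ z. ennreal (dist (fst z) (snd z) powr p) \<partial>\<pi>"
  let ?I = "INF \<pi> \<in> couplings \<mu> \<nu>. ?c \<pi>"
  have "?I < \<infinity>" using Pp_coupling_finite assms by blast
  then have "?I = ennreal (Wp p \<mu> \<nu> powr p)"
    using \<open>p > 0\<close> by (simp add: Wp_powr)
  also have "\<dots> < ennreal (A powr p)"
    using assms le_less_trans[OF Wp_nonneg assms(5)] by (intro ennreal_lessI powr_less_mono2) auto
  finally obtain \<pi> where "\<pi> \<in> couplings \<mu> \<nu>" "?c \<pi> < ennreal (A powr p)"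
    by (auto simp: INF_less_iff)
  then show ?thesis
    using that[of \<pi>] couplings_has_law[of \<pi> \<mu> \<nu>] by (auto simp: couplings_def)
qed

lemma Wp_commute:
  fixes \<mu> \<nu> :: "'a::metric_space measure"
  assumes sep: "separable_space TYPE('a)" and "\<mu> \<in> Pp p" "\<nu> \<in> Pp p" "p > 0"
  shows "Wp p \<mu> \<nu> = Wp p \<nu> \<mu>"
proof -
  have "Wp p \<beta> \<alpha> \<le> Wp p \<alpha> \<beta>" if \<alpha>\<beta>: "\<alpha> \<in> Pp p" "\<beta> \<in> Pp p" for \<alpha> \<beta> :: "'a measure"
  proof (rule dense_ge)
    fix A assume A: "Wp p \<alpha> \<beta> < A"
    obtain \<pi> where \<pi>: "prob_space \<pi>" "has_law \<pi> fst \<alpha>" "has_law \<pi> snd \<beta>"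
      "(\<integral>\<^sup>+ z. ennreal (dist (fst z) (snd z) powr p) \<partial>\<pi>) \<le> ennreal (A powr p)"
      using near_optimal_coupling[OF sep \<alpha>\<beta> \<open>p > 0\<close> A] by blast
    show "Wp p \<beta> \<alpha> \<le> A"
      using Wp_leI[OF sep \<open>p > 0\<close> \<pi>(1,3,2), of A] \<pi>(4) le_less_trans[OF Wp_nonneg A]
      by (simp add: dist_commute)
  qed
  then show ?thesis using assms by (intro antisym) auto
qed

section \<open>Minkowski's inequality, the triangle inequality and the equality case\<close>

lemma nn_integral_split_energy_le:
  assumes l: "0 < l" "l < 1" and [measurable]: "u \<in> borel_measurable M" "v \<in> borel_measurable M"
    and "(\<integral>\<^sup>+ \<omega>. ennreal (u \<omega> powr p) \<partial>M) \<le> ennreal (A powr p)"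
    and "(\<integral>\<^sup>+ \<omega>. ennreal (v \<omega> powr p) \<partial>M) \<le> ennreal (B powr p)"
  shows "(\<integral>\<^sup>+ \<omega>. ennreal (split_energy p l (u \<omega>) (v \<omega>)) \<partial>M) \<le> ennreal (split_energy p l A B)"
proof -
  have "(\<integral>\<^sup>+ \<omega>. ennreal (split_energy p l (u \<omega>) (v \<omega>)) \<partial>M) =
    (\<integral>\<^sup>+ \<omega>. ennreal (u \<omega> powr p) * ennreal (l powr (1 - p)) + ennreal (v \<omega> powr p) * ennreal ((1 - l) powr (1 - p)) \<partial>M)"
    by (simp add: split_energy_def ennreal_mult)
  also have "\<dots> = (\<integral>\<^sup>+ \<omega>. ennreal (u \<omega> powr p) \<partial>M) * ennreal (l powr (1 - p)) +
      (\<integral>\<^sup>+ \<omega>. ennreal (v \<omega> powr p) \<partial>M) * ennreal ((1 - l) powr (1 - p))"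
    by (simp add: nn_integral_add nn_integral_multc)
  also have "\<dots> \<le> ennreal (A powr p) * ennreal (l powr (1 - p)) + ennreal (B powr p) * ennreal ((1 - l) powr (1 - p))"
    using assms by (intro add_mono mult_right_mono) auto
  also have "\<dots> = ennreal (split_energy p l A B)"
    by (simp add: split_energy_def ennreal_mult)
  finally show ?thesis .
qed

text \<open>Pointwise Jensen with the single weight \<open>A / (A + B)\<close>, fixed by the norms,
  followed by integration; at this weight the energy of \<open>A\<close> and \<open>B\<close> is
  exactly \<open>(A + B) powr p\<close>.\<close>

lemma Minkowski_powr:
  fixes u v :: "'b \<Rightarrow> real"
  assumes "p > 1" "A > 0" "B > 0"
    and m: "u \<in> borel_measurable M" "v \<in> borel_measurable M"
    and nn: "\<And>\<omega>. u \<omega> \<ge> 0" "\<And>\<omega>. v \<omega> \<ge> 0"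
    and b: "(\<integral>\<^sup>+ \<omega>. ennreal (u \<omega> powr p) \<partial>M) \<le> ennreal (A powr p)"
      "(\<integral>\<^sup>+ \<omega>. ennreal (v \<omega> powr p) \<partial>M) \<le> ennreal (B powr p)"
  shows "(\<integral>\<^sup>+ \<omega>. ennreal ((u \<omega> + v \<omega>) powr p) \<partial>M) \<le> ennreal ((A + B) powr p)"
proof -
  let ?l = "A / (A + B)"
  have l: "0 < ?l" "?l < 1" using assms by auto
  have "(\<integral>\<^sup>+ \<omega>. ennreal ((u \<omega> + v \<omega>) powr p) \<partial>M) \<le> (\<integral>\<^sup>+ \<omega>. ennreal (split_energy p ?l (u \<omega>) (v \<omega>)) \<partial>M)"
    using l nn \<open>p > 1\<close> by (intro nn_integral_mono ennreal_leI powr_sum_le_split_energy) auto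
  also have "\<dots> \<le> ennreal (split_energy p ?l A B)"
    by (rule nn_integral_split_energy_le[OF l m b])
  also have "\<dots> = ennreal ((A + B) powr p)"
    using split_energy_optimal assms by simp
  finally show ?thesis .
qed

text \<open>Gluing two near-optimal plans gives two copies of the middle variable at distance below
  \<open>B - B'\<close>. The copy from the first plan is kept, and Minkowski pays for the change in
  the second cost.\<close>

lemma near_optimal_gluing:
  fixes \<mu>0 \<mu>1 \<mu>2 :: "'a::metric_space measure"
  assumes sep: "separable_space TYPE('a)" and "p > 1"
    and "\<mu>0 \<in> Pp p" "\<mu>1 \<in> Pp p" "\<mu>2 \<in> Pp p"
    and A: "Wp p \<mu>0 \<mu>1 < A" and B: "Wp p \<mu>1 \<mu>2 < B"
  obtains M and X Y Z :: "('a \<times> 'a) \<times> ('a \<times> 'a) \<Rightarrow> 'a" where "prob_space M"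
    "has_law M X \<mu>0" "has_law M Y \<mu>1" "has_law M Z \<mu>2"
    "(\<integral>\<^sup>+ \<omega>. ennreal (dist (X \<omega>) (Y \<omega>) powr p) \<partial>M) \<le> ennreal (A powr p)"
    "(\<integral>\<^sup>+ \<omega>. ennreal (dist (Y \<omega>) (Z \<omega>) powr p) \<partial>M) \<le> ennreal (B powr p)"
proof -
  have "p > 0" using \<open>p > 1\<close> by simp
  have ABpos: "A > 0" using le_less_trans[OF Wp_nonneg A] by simp
  \<comment> \<open>Halfway between the distance and \<open>B\<close>: one half is slack for the
    plan, the other for the mismatch of the two copies.\<close>
  define B' where "B' = (Wp p \<mu>1 \<mu>2 + B) / 2"
  have B': "Wp p \<mu>1 \<mu>2 < B'" "B' < B" using B by (auto simp: B'_def)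
  have "B' > 0" using le_less_trans[OF Wp_nonneg B'(1)] by simp
  obtain \<pi> where \<pi>: "prob_space \<pi>" "has_law \<pi> fst \<mu>0" "has_law \<pi> snd \<mu>1"
    "(\<integral>\<^sup>+ z. ennreal (dist (fst z) (snd z) powr p) \<partial>\<pi>) \<le> ennreal (A powr p)"
    using near_optimal_coupling[OF sep assms(3,4) \<open>p > 0\<close> A] by blast
  obtain \<rho> where \<rho>: "prob_space \<rho>" "has_law \<rho> fst \<mu>1" "has_law \<rho> snd \<mu>2"
    "(\<integral>\<^sup>+ z. ennreal (dist (fst z) (snd z) powr p) \<partial>\<rho>) \<le> ennreal (B' powr p)"
    using near_optimal_coupling[OF sep assms(4,5) \<open>p > 0\<close> B'(1)] by blast
  have pos: "B - B' > 0" using B' by simp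
  have eq: "distr \<pi> borel snd = distr \<rho> borel fst" using \<pi>(3) \<rho>(2) by (simp add: has_law_def)
  obtain M where M: "prob_space M" "sets M = sets (\<pi> \<Otimes>\<^sub>M \<rho>)" "distr M \<pi> fst = \<pi>" "distr M \<rho> snd = \<rho>"
    "AE z in M. dist (snd (fst z)) (fst (snd z)) < B - B'"
    using approx_gluing[OF sep \<pi>(1) \<rho>(1) has_law_measurable[OF \<pi>(3)] has_law_measurable[OF \<rho>(2)] eq pos]
    by blast
  have T: "fst \<in> measurable M \<pi>" "snd \<in> measurable M \<rho>"
    using measurable_fst[of \<pi> \<rho>] measurable_snd[of \<pi> \<rho>] by (simp_all cong: measurable_cong_sets add: M(2))
  let ?X = "\<lambda>\<omega>. fst (fst \<omega>)" and ?Y = "\<lambda>\<omega>. snd (fst \<omega>)" and ?Y' = "\<lambda>\<omega>. fst (snd \<omega>)" and ?Z = "\<lambda>\<omega>. snd (snd \<omega>)"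
  have laws: "has_law M ?X \<mu>0" "has_law M ?Y \<mu>1" "has_law M ?Y' \<mu>1" "has_law M ?Z \<mu>2"
    using has_law_compose[OF \<pi>(2) T(1) M(3)] has_law_compose[OF \<pi>(3) T(1) M(3)]
      has_law_compose[OF \<rho>(2) T(2) M(4)] has_law_compose[OF \<rho>(3) T(2) M(4)] by auto
  note meas = laws[THEN has_law_measurable]
  note dmeas = borel_measurable_dist_separable[OF sep]
  have [measurable]: "(\<lambda>z. dist (fst z) (snd z)) \<in> borel_measurable \<pi>"
    "(\<lambda>z. dist (fst z) (snd z)) \<in> borel_measurable \<rho>"
    using dmeas[OF has_law_measurable has_law_measurable] \<pi>(2,3) \<rho>(2,3) by blast+
  have 1: "(\<integral>\<^sup>+ \<omega>. ennreal (dist (?X \<omega>) (?Y \<omega>) powr p) \<partial>M) \<le> ennreal (A powr p)"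
  proof -
    have "(\<integral>\<^sup>+ z. ennreal (dist (fst z) (snd z) powr p) \<partial>distr M \<pi> fst) =
      (\<integral>\<^sup>+ \<omega>. ennreal (dist (?X \<omega>) (?Y \<omega>) powr p) \<partial>M)"
      by (intro nn_integral_distr T) measurable
    then show ?thesis using \<pi>(4) by (simp add: M(3))
  qed
  have 2: "(\<integral>\<^sup>+ \<omega>. ennreal (dist (?Y' \<omega>) (?Z \<omega>) powr p) \<partial>M) \<le> ennreal (B' powr p)"
  proof -
    have "(\<integral>\<^sup>+ z. ennreal (dist (fst z) (snd z) powr p) \<partial>distr M \<rho> snd) =
      (\<integral>\<^sup>+ \<omega>. ennreal (dist (?Y' \<omega>) (?Z \<omega>) powr p) \<partial>M)"
      by (intro nn_integral_distr T) measurable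
    then show ?thesis using \<rho>(4) by (simp add: M(4))
  qed
  interpret prob_space M by fact
  have "(\<integral>\<^sup>+ \<omega>. ennreal (dist (?Y \<omega>) (?Z \<omega>) powr p) \<partial>M) \<le>
    (\<integral>\<^sup>+ \<omega>. ennreal ((dist (?Y' \<omega>) (?Z \<omega>) + (B - B')) powr p) \<partial>M)"
    using M(5)
  proof (intro nn_integral_mono_AE, eventually_elim)
    case (elim \<omega>)
    show ?case
      using elim dist_triangle[of "?Y \<omega>" "?Z \<omega>" "?Y' \<omega>"] \<open>p > 0\<close>
      by (intro ennreal_leI powr_mono2) auto
  qed
  also have "\<dots> \<le> ennreal ((B' + (B - B')) powr p)"
    using pos \<open>p > 1\<close> \<open>B' > 0\<close> 2
    by (intro Minkowski_powr dmeas meas) (auto simp: emeasure_space_1)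
  finally have 3: "(\<integral>\<^sup>+ \<omega>. ennreal (dist (?Y \<omega>) (?Z \<omega>) powr p) \<partial>M) \<le> ennreal (B powr p)" by simp
  show ?thesis by (rule that[OF M(1) laws(1,2,4) 1 3])
qed

lemma Wp_triangle:
  fixes \<mu>0 \<mu>1 \<mu>2 :: "'a::metric_space measure"
  assumes sep: "separable_space TYPE('a)" and "p > 1"
    and P: "\<mu>0 \<in> Pp p" "\<mu>1 \<in> Pp p" "\<mu>2 \<in> Pp p"
  shows "Wp p \<mu>0 \<mu>2 \<le> Wp p \<mu>0 \<mu>1 + Wp p \<mu>1 \<mu>2"
proof (rule field_le_epsilon)
  fix e :: real assume "e > 0"
  define A B where "A = Wp p \<mu>0 \<mu>1 + e / 2" and "B = Wp p \<mu>1 \<mu>2 + e / 2"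
  have AB: "Wp p \<mu>0 \<mu>1 < A" "Wp p \<mu>1 \<mu>2 < B" using \<open>e > 0\<close> by (auto simp: A_def B_def)
  have pos: "A > 0" "B > 0" using AB Wp_nonneg by (meson le_less_trans)+
  obtain M and X Y Z :: "('a \<times> 'a) \<times> ('a \<times> 'a) \<Rightarrow> 'a" where M: "prob_space M"
    and laws: "has_law M X \<mu>0" "has_law M Y \<mu>1" "has_law M Z \<mu>2"
    and ints: "(\<integral>\<^sup>+ \<omega>. ennreal (dist (X \<omega>) (Y \<omega>) powr p) \<partial>M) \<le> ennreal (A powr p)"
      "(\<integral>\<^sup>+ \<omega>. ennreal (dist (Y \<omega>) (Z \<omega>) powr p) \<partial>M) \<le> ennreal (B powr p)"
    using near_optimal_gluing[OF sep \<open>p > 1\<close> P AB] by blast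
  note meas = laws[THEN has_law_measurable]
  have "(\<integral>\<^sup>+ \<omega>. ennreal (dist (X \<omega>) (Z \<omega>) powr p) \<partial>M) \<le>
    (\<integral>\<^sup>+ \<omega>. ennreal ((dist (X \<omega>) (Y \<omega>) + dist (Y \<omega>) (Z \<omega>)) powr p) \<partial>M)"
    using \<open>p > 1\<close> by (intro nn_integral_mono ennreal_leI powr_mono2 dist_triangle) auto
  also have "\<dots> \<le> ennreal ((A + B) powr p)"
    using pos \<open>p > 1\<close> ints by (intro Minkowski_powr borel_measurable_dist_separable[OF sep] meas) auto
  finally have "Wp p \<mu>0 \<mu>2 \<le> A + B"
    using pos \<open>p > 1\<close> by (intro Wp_leI[OF sep _ M laws(1,3)]) auto
  then show "Wp p \<mu>0 \<mu>2 \<le> Wp p \<mu>0 \<mu>1 + Wp p \<mu>1 \<mu>2 + e" by (simp add: A_def B_def)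
qed

text \<open>The equality case of Minkowski's inequality, in a quantitative form that needs neither
  optimal couplings nor exact gluing: \<open>E\<close> dominates the cost of the exceptional event.\<close>

lemma geodesic_three_point:
  fixes \<mu>0 \<mu>1 \<mu>2 :: "'a::metric_space measure"
  assumes sep: "separable_space TYPE('a)" and "p > 1"
    and P: "\<mu>0 \<in> Pp p" "\<mu>1 \<in> Pp p" "\<mu>2 \<in> Pp p"
    and l: "0 < l" "l < 1" and "L > 0"
    and W: "Wp p \<mu>0 \<mu>1 = l * L" "Wp p \<mu>1 \<mu>2 = (1 - l) * L" "Wp p \<mu>0 \<mu>2 = L" and "\<eta> > 0"
  obtains M and X Y Z :: "('a \<times> 'a) \<times> ('a \<times> 'a) \<Rightarrow> 'a" and E where "prob_space M"
    "has_law M X \<mu>0" "has_law M Y \<mu>1" "has_law M Z \<mu>2"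
    "E \<in> borel_measurable M" "(\<integral>\<^sup>+ \<omega>. E \<omega> \<partial>M) \<le> ennreal \<eta>"
    "\<And>\<omega>. ennreal ((dist (X \<omega>) (Y \<omega>) + dist (Y \<omega>) (Z \<omega>)) powr p) \<le> E \<omega> \<or>
       (l * (dist (X \<omega>) (Y \<omega>) + dist (Y \<omega>) (Z \<omega>)) / 2 \<le> dist (X \<omega>) (Y \<omega>) \<and>
        dist (X \<omega>) (Y \<omega>) \<le> 2 * l * (dist (X \<omega>) (Y \<omega>) + dist (Y \<omega>) (Z \<omega>)) \<and>
        dist (X \<omega>) (Y \<omega>) + dist (Y \<omega>) (Z \<omega>) \<le> 2 * dist (X \<omega>) (Z \<omega>))"
proof -
  obtain c0 where c0: "c0 > 0"
    "\<And>a b. \<lbrakk>a \<ge> 0; b \<ge> 0; a < l * (a + b) / 2 \<or> a > 2 * l * (a + b)\<rbrakk>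
       \<Longrightarrow> (1 + c0) * (a + b) powr p \<le> split_energy p l a b"
    using split_energy_deficit[OF \<open>p > 1\<close> l] by blast
  \<comment> \<open>If the path is longer than twice the direct distance \<open>D\<close>, then
    \<open>D powr p\<close> loses at least the fraction \<open>k\<close> of the p-th power of the
    path length.\<close>
  define k where "k = 1 - (1/2 :: real) powr p"
  have "k > 0" using powr_less_mono2[of p "1/2" 1] \<open>p > 1\<close> by (simp add: k_def)
  define c where "c = min c0 k"
  have c: "c > 0" "c \<le> c0" "c \<le> k" using c0(1) \<open>k > 0\<close> by (auto simp: c_def)
  \<comment> \<open>Slightly larger than \<open>L\<close>, with
    \<open>K powr p - L powr p = c * \<eta>\<close>: the total energy surplus that the near-optimal
    plans are granted.\<close>
  define K where "K = (L powr p + c * \<eta>) powr (1 / p)"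
  have Kp: "K powr p = L powr p + c * \<eta>"
    using c \<open>\<eta> > 0\<close> \<open>p > 1\<close> by (simp add: K_def powr_powr)
  have "K > L"
  proof (rule ccontr)
    assume "\<not> L < K"
    then have "K powr p \<le> L powr p" using \<open>p > 1\<close> by (intro powr_mono2) (auto simp: K_def)
    then show False using Kp c \<open>\<eta> > 0\<close> by (simp add: mult_le_0_iff)
  qed
  have AB: "Wp p \<mu>0 \<mu>1 < l * K" "Wp p \<mu>1 \<mu>2 < (1 - l) * K" using \<open>K > L\<close> l W by auto
  obtain M and X Y Z :: "('a \<times> 'a) \<times> ('a \<times> 'a) \<Rightarrow> 'a" where M: "prob_space M"
    and laws: "has_law M X \<mu>0" "has_law M Y \<mu>1" "has_law M Z \<mu>2"
    and ints: "(\<integral>\<^sup>+ \<omega>. ennreal (dist (X \<omega>) (Y \<omega>) powr p) \<partial>M) \<le> ennreal ((l * K) powr p)"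
      "(\<integral>\<^sup>+ \<omega>. ennreal (dist (Y \<omega>) (Z \<omega>) powr p) \<partial>M) \<le> ennreal (((1 - l) * K) powr p)"
    using near_optimal_gluing[OF sep \<open>p > 1\<close> P AB] by blast
  note meas = laws[THEN has_law_measurable]
  define a b D where "a \<omega> = dist (X \<omega>) (Y \<omega>)" and "b \<omega> = dist (Y \<omega>) (Z \<omega>)" and "D \<omega> = dist (X \<omega>) (Z \<omega>)" for \<omega>
  have [measurable]: "a \<in> borel_measurable M" "b \<in> borel_measurable M" "D \<in> borel_measurable M"
    unfolding a_def b_def D_def by (intro borel_measurable_dist_separable[OF sep] meas)+
  \<comment> \<open>The share of the first leg is off by more than a factor 2, or the path is more
    than twice the direct distance. Off this event the second alternative of the conclusion holds;
    on it \<open>E\<close> is the p-th power of the path length.\<close>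
  define Bad where "Bad \<omega> \<longleftrightarrow> a \<omega> < l * (a \<omega> + b \<omega>) / 2 \<or> a \<omega> > 2 * l * (a \<omega> + b \<omega>) \<or> a \<omega> + b \<omega> > 2 * D \<omega>" for \<omega>
  have [measurable]: "Measurable.pred M Bad" unfolding Bad_def by measurable
  define E where "E \<omega> = (if Bad \<omega> then ennreal ((a \<omega> + b \<omega>) powr p) else 0)" for \<omega>
  have [measurable]: "E \<in> borel_measurable M" unfolding E_def by measurable
  have ab: "a \<omega> \<ge> 0" "b \<omega> \<ge> 0" "D \<omega> \<ge> 0" "D \<omega> \<le> a \<omega> + b \<omega>" for \<omega>
    by (auto simp: a_def b_def D_def dist_triangle)
  \<comment> \<open>Pointwise the energy exceeds \<open>D powr p\<close> by at least
    \<open>c\<close> times the cost of a bad triple: through \<open>k\<close> if the path is too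
    long, through \<open>c0\<close> if the split is wrong.\<close>
  have pw: "ennreal (D \<omega> powr p) + ennreal c * E \<omega> \<le> ennreal (split_energy p l (a \<omega>) (b \<omega>))" for \<omega>
  proof -
    let ?S = "a \<omega> + b \<omega>"
    have DS: "D \<omega> powr p \<le> ?S powr p" using ab \<open>p > 1\<close> by (intro powr_mono2) auto
    have SG: "?S powr p \<le> split_energy p l (a \<omega>) (b \<omega>)"
      using ab \<open>p > 1\<close> l by (intro powr_sum_le_split_energy) auto
    have "D \<omega> powr p + c * ?S powr p \<le> split_energy p l (a \<omega>) (b \<omega>)" if "Bad \<omega>"
    proof (cases "?S > 2 * D \<omega>")
      case True
      have "D \<omega> powr p \<le> (?S * (1/2)) powr p" using ab \<open>p > 1\<close> True by (intro powr_mono2) auto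
      also have "\<dots> = ?S powr p * (1 - k)"
        using ab[of \<omega>] by (subst powr_mult) (auto simp: k_def)
      finally have "D \<omega> powr p + k * ?S powr p \<le> ?S powr p" by (simp add: algebra_simps)
      moreover have "c * ?S powr p \<le> k * ?S powr p" using c by (intro mult_right_mono) auto
      ultimately show ?thesis using SG by linarith
    next
      case False
      then have "(1 + c0) * ?S powr p \<le> split_energy p l (a \<omega>) (b \<omega>)"
        using that ab by (intro c0(2)) (auto simp: Bad_def)
      moreover have "c * ?S powr p \<le> c0 * ?S powr p" using c by (intro mult_right_mono) auto
      ultimately show ?thesis using DS by (simp add: algebra_simps)
    qed
    then show ?thesis
      using DS SG c by (auto simp: E_def ennreal_leI simp flip: ennreal_plus ennreal_mult)
  qed
  \<comment> \<open>Any coupling of \<open>\<mu>0\<close> and \<open>\<mu>2\<close> costs at least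
    \<open>L powr p\<close>, while the energy integrates to at most
    \<open>K powr p = L powr p + c * \<eta>\<close>. Cancelling the finite term
    \<open>L powr p\<close> and then \<open>c\<close> bounds the integral of
    \<open>E\<close>.\<close>
  have "ennreal (L powr p) + ennreal c * (\<integral>\<^sup>+ \<omega>. E \<omega> \<partial>M) \<le>
      (\<integral>\<^sup>+ \<omega>. ennreal (D \<omega> powr p) \<partial>M) + ennreal c * (\<integral>\<^sup>+ \<omega>. E \<omega> \<partial>M)"
    using Wp_powr_le[OF sep _ M laws(1,3), of p] \<open>p > 1\<close> W by (intro add_mono) (auto simp: D_def)
  also have "\<dots> = (\<integral>\<^sup>+ \<omega>. ennreal (D \<omega> powr p) + ennreal c * E \<omega> \<partial>M)"
    by (simp add: nn_integral_add nn_integral_cmult)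
  also have "\<dots> \<le> (\<integral>\<^sup>+ \<omega>. ennreal (split_energy p l (a \<omega>) (b \<omega>)) \<partial>M)"
    by (intro nn_integral_mono pw)
  also have "\<dots> \<le> ennreal (split_energy p l (l * K) ((1 - l) * K))"
    using ints by (intro nn_integral_split_energy_le l) (auto simp flip: a_def b_def)
  also have "split_energy p l (l * K) ((1 - l) * K) = L powr p + c * \<eta>"
  proof -
    have "l * K + (1 - l) * K = K" by (simp add: algebra_simps)
    then show ?thesis
      using split_energy_optimal[of "l * K" "(1 - l) * K" p] l \<open>K > L\<close> \<open>L > 0\<close> Kp by simp
  qed
  also have "ennreal \<dots> = ennreal (L powr p) + ennreal c * ennreal \<eta>"
    using c \<open>\<eta> > 0\<close> by (simp add: ennreal_mult)
  finally have "(\<integral>\<^sup>+ \<omega>. E \<omega> \<partial>M) \<le> ennreal \<eta>"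
    using c by (simp add: ennreal_mult_le_mult_iff)
  moreover have "ennreal ((a \<omega> + b \<omega>) powr p) \<le> E \<omega> \<or>
       (l * (a \<omega> + b \<omega>) / 2 \<le> a \<omega> \<and> a \<omega> \<le> 2 * l * (a \<omega> + b \<omega>) \<and> a \<omega> + b \<omega> \<le> 2 * D \<omega>)" for \<omega>
    by (auto simp: E_def Bad_def)
  ultimately show ?thesis
    using that[OF M laws, of E] unfolding a_def b_def D_def by auto
qed

section \<open>Uniform integrability along geodesics\<close>

text \<open>Uniform smallness of \<open>tail\<close> for large \<open>R\<close> is uniform
  integrability of the p-th power of the distance to \<open>z\<close>. The scale \<open>s\<close> is
  1 at fixed times and the time itself along a ray, whose measures drift to infinity.\<close>

definition tail :: "real \<Rightarrow> 'a::metric_space \<Rightarrow> real \<Rightarrow> real \<Rightarrow> 'a measure \<Rightarrow> ennreal" where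
  "tail p z s R \<mu> = (\<integral>\<^sup>+ x. ennreal (excess p R (dist x z / s)) \<partial>\<mu>)"

lemma excess_dist_measurable [measurable]:
  "(\<lambda>x. ennreal (excess p R (dist x z / s))) \<in> borel_measurable borel"
proof -
  have "(\<lambda>x. dist x z / s) \<in> borel_measurable borel"
    unfolding divide_inverse by (intro borel_measurable_continuous_onI continuous_intros)
  then show ?thesis by measurable
qed

lemma tail_antimono:
  assumes "p \<ge> 0" "S \<le> R"
  shows "tail p z s R \<mu> \<le> tail p z s S \<mu>"
  unfolding tail_def using assms by (intro nn_integral_mono ennreal_leI excess_mono) auto

text \<open>Dominated convergence along integer thresholds, with the p-th power of the distance as
  majorant.\<close>

lemma tail_vanishes:
  assumes \<mu>: "\<mu> \<in> Pp p" and "p > 0" "e > 0"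
  obtains R where "R \<ge> 0" "tail p z 1 R \<mu> \<le> ennreal e"
proof -
  have s: "sets \<mu> = sets borel" using \<mu> by (simp add: Pp_def)
  have m: "f \<in> borel_measurable borel \<Longrightarrow> f \<in> borel_measurable \<mu>" for f :: "'a \<Rightarrow> ennreal"
    by (simp cong: measurable_cong_sets add: s)
  have md: "(\<lambda>x. ennreal (dist x z powr p)) \<in> borel_measurable borel"
  proof -
    have [measurable]: "(\<lambda>x. dist x z) \<in> borel_measurable borel"
      by (intro borel_measurable_continuous_onI continuous_intros)
    show ?thesis by measurable
  qed
  have "(\<lambda>n. \<integral>\<^sup>+ x. ennreal (excess p (real n) (dist x z / 1)) \<partial>\<mu>) \<longlonglongrightarrow> (\<integral>\<^sup>+ x. 0 \<partial>\<mu>)"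
  proof (rule nn_integral_dominated_convergence[where w="\<lambda>x. ennreal (dist x z powr p)"])
    show "(\<integral>\<^sup>+ x. ennreal (dist x z powr p) \<partial>\<mu>) < \<infinity>" by (rule Pp_moment_finite[OF \<mu> \<open>p > 0\<close>])
    show "AE x in \<mu>. ennreal (excess p (real n) (dist x z / 1)) \<le> ennreal (dist x z powr p)" for n
      using excess_le_powr[of p "real n"] \<open>p > 0\<close> by (auto intro!: ennreal_leI)
    show "AE x in \<mu>. (\<lambda>n. ennreal (excess p (real n) (dist x z / 1))) \<longlonglongrightarrow> 0"
    proof (rule AE_I2)
      fix x
      obtain N where N: "dist x z \<le> real N" using real_arch_simple by blast
      have "excess p (real n) (dist x z) = 0" if "n \<ge> N" for n
        using N that by (simp add: excess_def max_def)
      then show "(\<lambda>n. ennreal (excess p (real n) (dist x z / 1))) \<longlonglongrightarrow> 0"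
        by (intro tendsto_eventually) (auto simp: eventually_sequentially intro!: exI[of _ N])
    qed
  qed (simp_all only: m md excess_dist_measurable borel_measurable_const)
  then have "(\<lambda>n. tail p z 1 (real n) \<mu>) \<longlonglongrightarrow> 0" by (simp add: tail_def)
  then have "\<forall>\<^sub>F n in sequentially. tail p z 1 (real n) \<mu> < ennreal e"
    using \<open>e > 0\<close> by (intro order_tendstoD) auto
  then obtain n where "tail p z 1 (real n) \<mu> < ennreal e" by (auto simp: eventually_sequentially)
  then show ?thesis using that[of "real n"] by auto
qed

text \<open>The integration step shared by the endpoint and the interior estimate, which differ only
  in their pointwise inequality.\<close>

lemma tail_le_of_pointwise:
  assumes laws: "has_law M X \<mu>" "has_law M Y \<nu>" "has_law M Z \<rho>"
    and [measurable]: "E \<in> borel_measurable M"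
    and pw: "\<And>\<omega>. ennreal (excess p R (dist (X \<omega>) z / s)) \<le> c * E \<omega> +
      C * (ennreal (excess p R1 (dist (Y \<omega>) z / s1)) + ennreal (excess p R2 (dist (Z \<omega>) z / s2)))"
  shows "tail p z s R \<mu> \<le> c * (\<integral>\<^sup>+ \<omega>. E \<omega> \<partial>M) + C * (tail p z s1 R1 \<nu> + tail p z s2 R2 \<rho>)"
proof -
  have [measurable]: "(\<lambda>\<omega>. ennreal (excess p R1 (dist (Y \<omega>) z / s1))) \<in> borel_measurable M"
    "(\<lambda>\<omega>. ennreal (excess p R2 (dist (Z \<omega>) z / s2))) \<in> borel_measurable M"
    using laws(2,3)[THEN has_law_measurable] measurable_compose[OF _ excess_dist_measurable] by blast+
  have "tail p z s R \<mu> \<le> (\<integral>\<^sup>+ \<omega>. c * E \<omega> +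
      C * (ennreal (excess p R1 (dist (Y \<omega>) z / s1)) + ennreal (excess p R2 (dist (Z \<omega>) z / s2))) \<partial>M)"
    unfolding tail_def nn_integral_has_law[OF laws(1) excess_dist_measurable]
    by (intro nn_integral_mono pw)
  also have "\<dots> = c * (\<integral>\<^sup>+ \<omega>. E \<omega> \<partial>M) + C * (tail p z s1 R1 \<nu> + tail p z s2 R2 \<rho>)"
    unfolding tail_def nn_integral_has_law[OF laws(2) excess_dist_measurable]
      nn_integral_has_law[OF laws(3) excess_dist_measurable]
    by (subst nn_integral_add, measurable, subst (1 2) nn_integral_cmult, measurable,
        subst nn_integral_add) measurable
  finally show ?thesis .
qed

text \<open>The displacement enters \<open>excess_add\<close> with threshold 0, that is, with its
  full p-th power; hence the threshold \<open>R\<close> stays the same on both sides.\<close>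

lemma tail_le_of_Wp:
  fixes \<mu> \<nu> :: "'a::metric_space measure"
  assumes sep: "separable_space TYPE('a)" and "\<mu> \<in> Pp p" "\<nu> \<in> Pp p" "p > 0" "Wp p \<mu> \<nu> < A"
  shows "tail p z 1 R \<mu> \<le> ennreal (2 powr p) * (tail p z 1 R \<nu> + ennreal (A powr p))"
proof -
  obtain \<pi> where \<pi>: "prob_space \<pi>" "has_law \<pi> fst \<mu>" "has_law \<pi> snd \<nu>"
    "(\<integral>\<^sup>+ z. ennreal (dist (fst z) (snd z) powr p) \<partial>\<pi>) \<le> ennreal (A powr p)"
    using near_optimal_coupling[OF assms] by blast
  have [measurable]: "(\<lambda>\<omega>. ennreal (excess p R (dist (snd \<omega>) z / 1))) \<in> borel_measurable \<pi>"
    using \<pi>(3)[THEN has_law_measurable] measurable_compose[OF _ excess_dist_measurable] by blast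
  have [measurable]: "(\<lambda>z. dist (fst z) (snd z)) \<in> borel_measurable \<pi>"
    using borel_measurable_dist_separable[OF sep] \<pi>(2,3)[THEN has_law_measurable] by blast
  have "tail p z 1 R \<mu> \<le> (\<integral>\<^sup>+ \<omega>. ennreal (2 powr p) *
      (ennreal (excess p R (dist (snd \<omega>) z / 1)) + ennreal (dist (fst \<omega>) (snd \<omega>) powr p)) \<partial>\<pi>)"
    unfolding tail_def nn_integral_has_law[OF \<pi>(2) excess_dist_measurable]
  proof (rule nn_integral_mono)
    fix \<omega> :: "'a \<times> 'a"
    have "excess p R (dist (fst \<omega>) z) \<le> excess p (R + 0) (dist (snd \<omega>) z + dist (fst \<omega>) (snd \<omega>))"
      using \<open>p > 0\<close> dist_triangle[of "fst \<omega>" z "snd \<omega>"] by (intro excess_mono) auto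
    also have "\<dots> \<le> 2 powr p * (excess p R (dist (snd \<omega>) z) + excess p 0 (dist (fst \<omega>) (snd \<omega>)))"
      using \<open>p > 0\<close> by (intro excess_add) auto
    also have "excess p 0 (dist (fst \<omega>) (snd \<omega>)) = dist (fst \<omega>) (snd \<omega>) powr p"
      by (simp add: excess_def)
    finally show "ennreal (excess p R (dist (fst \<omega>) z / 1)) \<le> ennreal (2 powr p) *
      (ennreal (excess p R (dist (snd \<omega>) z / 1)) + ennreal (dist (fst \<omega>) (snd \<omega>) powr p))"
      by (simp flip: ennreal_plus ennreal_mult add: ennreal_leI)
  qed
  also have "\<dots> = ennreal (2 powr p) *
      (tail p z 1 R \<nu> + (\<integral>\<^sup>+ \<omega>. ennreal (dist (fst \<omega>) (snd \<omega>) powr p) \<partial>\<pi>))"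
    unfolding tail_def nn_integral_has_law[OF \<pi>(3) excess_dist_measurable]
    by (subst nn_integral_cmult, measurable, subst nn_integral_add) measurable
  also have "\<dots> \<le> ennreal (2 powr p) * (tail p z 1 R \<nu> + ennreal (A powr p))"
    by (intro mult_left_mono add_mono \<pi>(4)) auto
  finally show ?thesis .
qed

lemma tails_vanish_of_Wp_convergent:
  fixes \<nu> :: "'a::metric_space measure"
  assumes sep: "separable_space TYPE('a)" and \<mu>: "\<forall>n. \<mu> n \<in> Pp p" and \<nu>: "\<nu> \<in> Pp p" and "p > 0"
    and conv: "(\<lambda>n. Wp p (\<mu> n) \<nu>) \<longlonglongrightarrow> 0" and "e > 0"
  obtains R where "R \<ge> 0" "\<forall>\<^sub>F n in sequentially. tail p z 1 R (\<mu> n) \<le> ennreal e"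
proof -
  define e' where "e' = e / (2 * 2 powr p)"
  have "e' > 0" using \<open>e > 0\<close> by (simp add: e'_def)
  define A where "A = e' powr (1 / p)"
  have "A > 0" "A powr p = e'" using \<open>e' > 0\<close> \<open>p > 0\<close> by (auto simp: A_def powr_powr)
  obtain R where R: "R \<ge> 0" "tail p z 1 R \<nu> \<le> ennreal e'"
    using tail_vanishes[OF \<nu> \<open>p > 0\<close> \<open>e' > 0\<close>] by blast
  have "\<forall>\<^sub>F n in sequentially. Wp p (\<mu> n) \<nu> < A"
    using conv \<open>A > 0\<close> by (rule order_tendstoD)
  then have "\<forall>\<^sub>F n in sequentially. tail p z 1 R (\<mu> n) \<le> ennreal e"
  proof eventually_elim
    case (elim n)
    have "tail p z 1 R (\<mu> n) \<le> ennreal (2 powr p) * (tail p z 1 R \<nu> + ennreal (A powr p))"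
      using tail_le_of_Wp[OF sep _ \<nu> \<open>p > 0\<close> elim] \<mu> by blast
    also have "\<dots> \<le> ennreal (2 powr p) * (ennreal e' + ennreal e')"
      using R(2) \<open>A powr p = e'\<close> by (intro mult_left_mono add_mono) auto
    also have "\<dots> = ennreal (2 powr p * (e' + e'))"
      using \<open>e' > 0\<close> by (simp flip: ennreal_plus ennreal_mult)
    also have "2 powr p * (e' + e') = e" by (simp add: e'_def)
    finally show ?case .
  qed
  then show ?thesis using that R(1) by blast
qed

text \<open>Off the exceptional event the first leg has at least half its share: with
  \<open>l = 1 / L\<close>, \<open>l * S <= 2 * dist X Y <= 2 * dX + 2 * dY\<close>, and
  \<open>dZ / L <= dX + l * S\<close>. So only times 0 and 1 remain, for every \<open>L\<close>.
  \<open>R\<close> is halved for the sum \<open>dX + l * S\<close>, and this half is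
  \<open>2 * (R / 8) + 2 * (R / 8)\<close>; \<open>8 powr p\<close> collects two uses of
  \<open>excess_add\<close> and one scaling by 2.\<close>

lemma geodesic_endpoint_tail:
  fixes \<mu>0 \<mu>1 \<mu>2 :: "'a::metric_space measure"
  assumes sep: "separable_space TYPE('a)" and "p > 1"
    and P: "\<mu>0 \<in> Pp p" "\<mu>1 \<in> Pp p" "\<mu>2 \<in> Pp p"
    and "L > 1" and W: "Wp p \<mu>0 \<mu>1 = 1" "Wp p \<mu>1 \<mu>2 = L - 1" "Wp p \<mu>0 \<mu>2 = L" and "R \<ge> 0"
  shows "tail p z L R \<mu>2 \<le> ennreal (2 powr p + 8 powr p) * (tail p z 1 (R / 8) \<mu>0 + tail p z 1 (R / 8) \<mu>1)"
proof (rule ennreal_le_epsilon)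
  fix e :: real assume "e > 0"
  define l where "l = 1 / L"
  have l: "0 < l" "l < 1" "L > 0" using \<open>L > 1\<close> by (auto simp: l_def)
  have W': "Wp p \<mu>0 \<mu>1 = l * L" "Wp p \<mu>1 \<mu>2 = (1 - l) * L"
    using W l by (auto simp: l_def field_simps)
  \<comment> \<open>The exceptional cost enters the bound with factor \<open>2 powr p\<close>, so
    with this slack it contributes at most \<open>e\<close>.\<close>
  have "e / 2 powr p > 0" using \<open>e > 0\<close> by simp
  obtain M and X Y Z :: "('a \<times> 'a) \<times> ('a \<times> 'a) \<Rightarrow> 'a" and E where M: "prob_space M"
    and laws: "has_law M X \<mu>0" "has_law M Y \<mu>1" "has_law M Z \<mu>2"
    and E: "E \<in> borel_measurable M" "(\<integral>\<^sup>+ \<omega>. E \<omega> \<partial>M) \<le> ennreal (e / 2 powr p)"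
    and good: "\<And>\<omega>. ennreal ((dist (X \<omega>) (Y \<omega>) + dist (Y \<omega>) (Z \<omega>)) powr p) \<le> E \<omega> \<or>
       (l * (dist (X \<omega>) (Y \<omega>) + dist (Y \<omega>) (Z \<omega>)) / 2 \<le> dist (X \<omega>) (Y \<omega>) \<and>
        dist (X \<omega>) (Y \<omega>) \<le> 2 * l * (dist (X \<omega>) (Y \<omega>) + dist (Y \<omega>) (Z \<omega>)) \<and>
        dist (X \<omega>) (Y \<omega>) + dist (Y \<omega>) (Z \<omega>) \<le> 2 * dist (X \<omega>) (Z \<omega>))"
    using geodesic_three_point[OF sep \<open>p > 1\<close> P l W' W(3) \<open>e / 2 powr p > 0\<close>] by blast
  have "p \<ge> 0" using \<open>p > 1\<close> by simp
  have "tail p z L R \<mu>2 \<le> ennreal (2 powr p) * (\<integral>\<^sup>+ \<omega>. E \<omega> \<partial>M) +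
    ennreal (2 powr p + 8 powr p) * (tail p z 1 (R / 8) \<mu>0 + tail p z 1 (R / 8) \<mu>1)"
  proof (rule tail_le_of_pointwise[OF laws(3,1,2) E(1)])
    fix \<omega>
    define S dX dY dZ where "S = dist (X \<omega>) (Y \<omega>) + dist (Y \<omega>) (Z \<omega>)"
      and "dX = dist (X \<omega>) z" and "dY = dist (Y \<omega>) z" and "dZ = dist (Z \<omega>) z"
    have nn: "S \<ge> 0" "dX \<ge> 0" "dY \<ge> 0" "dZ \<ge> 0" by (auto simp: S_def dX_def dY_def dZ_def)
    have "dZ \<le> dX + S"
      using dist_triangle[of "Z \<omega>" z "X \<omega>"] dist_triangle[of "Z \<omega>" "X \<omega>" "Y \<omega>"]
      by (simp add: S_def dX_def dZ_def dist_commute)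
    then have "dZ / L \<le> (dX + S) / L" using l by (simp add: divide_right_mono)
    also have "\<dots> \<le> dX + l * S"
      using l \<open>L > 1\<close> nn mult_left_mono[of 1 L dX] by (simp add: l_def field_simps)
    finally have "excess p R (dZ / L) \<le> excess p (R / 2 + R / 2) (dX + l * S)"
      using \<open>p \<ge> 0\<close> by (intro excess_mono) auto
    also have "\<dots> \<le> 2 powr p * (excess p (R / 2) dX + excess p (R / 2) (l * S))"
      by (intro excess_add \<open>p \<ge> 0\<close>)
    also have "\<dots> \<le> 2 powr p * (excess p (R / 8) dX + excess p (R / 2) (l * S))"
      using l \<open>R \<ge> 0\<close> \<open>p \<ge> 0\<close> by (intro mult_left_mono add_mono excess_mono) auto
    finally have main: "excess p R (dZ / L) \<le> 2 powr p * excess p (R / 8) dX + 2 powr p * excess p (R / 2) (l * S)"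
      by (simp add: distrib_left)
    have C: "2 powr p * excess p (R / 8) dX \<le> (2 powr p + 8 powr p) * (excess p (R / 8) dX + excess p (R / 8) dY)"
      by (intro mult_mono) auto
    consider "ennreal (S powr p) \<le> E \<omega>" | "l * S \<le> 2 * dist (X \<omega>) (Y \<omega>)"
      using good[of \<omega>] by (fastforce simp flip: S_def)
    then show "ennreal (excess p R (dist (Z \<omega>) z / L)) \<le> ennreal (2 powr p) * E \<omega> + ennreal (2 powr p + 8 powr p) *
        (ennreal (excess p (R / 8) (dist (X \<omega>) z / 1)) + ennreal (excess p (R / 8) (dist (Y \<omega>) z / 1)))"
    proof cases
      case 1
      have "excess p (R / 2) (l * S) \<le> (l * S) powr p"
        using \<open>R \<ge> 0\<close> \<open>p \<ge> 0\<close> nn l by (intro excess_le_powr) auto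
      also have "\<dots> \<le> S powr p"
        using l nn \<open>p \<ge> 0\<close> by (intro powr_mono2) (auto simp: mult_left_le_one_le)
      finally have "excess p R (dZ / L) \<le> 2 powr p * S powr p + (2 powr p + 8 powr p) * (excess p (R / 8) dX + excess p (R / 8) dY)"
        using main C by (smt (verit, best) mult_left_mono powr_ge_zero)
      then have "ennreal (excess p R (dZ / L)) \<le> ennreal (2 powr p) * ennreal (S powr p) +
          ennreal (2 powr p + 8 powr p) * (ennreal (excess p (R / 8) dX) + ennreal (excess p (R / 8) dY))"
        by (simp flip: ennreal_plus ennreal_mult add: ennreal_leI)
      also have "\<dots> \<le> ennreal (2 powr p) * E \<omega> +
          ennreal (2 powr p + 8 powr p) * (ennreal (excess p (R / 8) dX) + ennreal (excess p (R / 8) dY))"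
        using 1 by (intro add_mono mult_left_mono) auto
      finally show ?thesis by (simp add: dX_def dY_def dZ_def)
    next
      case 2
      have "l * S \<le> 2 * dX + 2 * dY"
        using 2 dist_triangle2[of "X \<omega>" "Y \<omega>" z] by (simp add: dX_def dY_def)
      then have "excess p (R / 2) (l * S) \<le> excess p (2 * (R / 8) + 2 * (R / 8)) (2 * dX + 2 * dY)"
        using \<open>p \<ge> 0\<close> by (intro excess_mono) auto
      also have "\<dots> \<le> 2 powr p * (excess p (2 * (R / 8)) (2 * dX) + excess p (2 * (R / 8)) (2 * dY))"
        by (intro excess_add \<open>p \<ge> 0\<close>)
      also have "\<dots> = 4 powr p * (excess p (R / 8) dX + excess p (R / 8) dY)"
        unfolding excess_scale[of 2, simplified] using powr_mult[of 2 2 p]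
        by (simp add: distrib_left)
      finally have "2 powr p * excess p (R / 2) (l * S) \<le> 2 powr p * (4 powr p * (excess p (R / 8) dX + excess p (R / 8) dY))"
        by (intro mult_left_mono) auto
      also have "\<dots> = 8 powr p * (excess p (R / 8) dX + excess p (R / 8) dY)"
        using powr_mult[of 2 4 p] by simp
      finally have "excess p R (dZ / L) \<le> 2 powr p * (excess p (R / 8) dX + excess p (R / 8) dY) + 8 powr p * (excess p (R / 8) dX + excess p (R / 8) dY)"
        using main by (smt (verit, best) mult_left_mono powr_ge_zero excess_nonneg)
      then have "ennreal (excess p R (dZ / L)) \<le>
          ennreal (2 powr p + 8 powr p) * (ennreal (excess p (R / 8) dX) + ennreal (excess p (R / 8) dY))"
        by (simp flip: ennreal_plus ennreal_mult add: ennreal_leI distrib_right)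
      then show ?thesis by (simp add: dX_def dY_def dZ_def add_increasing)
    qed
  qed
  also have "ennreal (2 powr p) * (\<integral>\<^sup>+ \<omega>. E \<omega> \<partial>M) \<le> ennreal (2 powr p) * ennreal (e / 2 powr p)"
    by (intro mult_left_mono E) auto
  also have "\<dots> = ennreal e" using \<open>e > 0\<close> by (simp flip: ennreal_mult)
  finally show "tail p z L R \<mu>2 \<le> ennreal (2 powr p + 8 powr p) * (tail p z 1 (R / 8) \<mu>0 + tail p z 1 (R / 8) \<mu>1) + ennreal e"
    by (simp add: add.commute)
qed

text \<open>Here the opposite bound is used: off the exceptional event \<open>a <= 2 * l * S\<close>
  and \<open>S <= 2 * dist X Z\<close>, whence \<open>a <= 4 * dX + 8 * t * (dZ / T)\<close>. The
  scale \<open>T\<close> is separate from the length \<open>L\<close> because it will be the time on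
  the ray. The thresholds \<open>4 * (R / 16)\<close> and \<open>8 * t * (R / (32 * t))\<close> are
  both \<open>R / 4\<close>; the scalings by 4 and \<open>8 * t\<close>, with
  \<open>2 powr p\<close> twice, give \<open>16 powr p\<close> and
  \<open>(32 * t) powr p\<close>.\<close>

lemma geodesic_interior_tail:
  fixes \<mu>0 \<mu>1 \<mu>2 :: "'a::metric_space measure"
  assumes sep: "separable_space TYPE('a)" and "p > 1"
    and P: "\<mu>0 \<in> Pp p" "\<mu>1 \<in> Pp p" "\<mu>2 \<in> Pp p"
    and t: "0 < t" "t < L" and W: "Wp p \<mu>0 \<mu>1 = t" "Wp p \<mu>1 \<mu>2 = L - t" "Wp p \<mu>0 \<mu>2 = L"
    and "R \<ge> 0" "T > 0" "T \<le> 2 * L"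
  shows "tail p z 1 R \<mu>1 \<le> ennreal (2 powr p + 16 powr p + (32 * t) powr p) *
    (tail p z 1 (R / 16) \<mu>0 + tail p z T (R / (32 * t)) \<mu>2)"
proof (rule ennreal_le_epsilon)
  fix e :: real assume "e > 0"
  define l where "l = t / L"
  have l: "0 < l" "l < 1" "L > 0" using t by (auto simp: l_def)
  have W': "Wp p \<mu>0 \<mu>1 = l * L" "Wp p \<mu>1 \<mu>2 = (1 - l) * L"
    using W l by (auto simp: l_def field_simps)
  have "e / 2 powr p > 0" using \<open>e > 0\<close> by simp
  obtain M and X Y Z :: "('a \<times> 'a) \<times> ('a \<times> 'a) \<Rightarrow> 'a" and E where M: "prob_space M"
    and laws: "has_law M X \<mu>0" "has_law M Y \<mu>1" "has_law M Z \<mu>2"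
    and E: "E \<in> borel_measurable M" "(\<integral>\<^sup>+ \<omega>. E \<omega> \<partial>M) \<le> ennreal (e / 2 powr p)"
    and good: "\<And>\<omega>. ennreal ((dist (X \<omega>) (Y \<omega>) + dist (Y \<omega>) (Z \<omega>)) powr p) \<le> E \<omega> \<or>
       (l * (dist (X \<omega>) (Y \<omega>) + dist (Y \<omega>) (Z \<omega>)) / 2 \<le> dist (X \<omega>) (Y \<omega>) \<and>
        dist (X \<omega>) (Y \<omega>) \<le> 2 * l * (dist (X \<omega>) (Y \<omega>) + dist (Y \<omega>) (Z \<omega>)) \<and>
        dist (X \<omega>) (Y \<omega>) + dist (Y \<omega>) (Z \<omega>) \<le> 2 * dist (X \<omega>) (Z \<omega>))"
    using geodesic_three_point[OF sep \<open>p > 1\<close> P l W' W(3) \<open>e / 2 powr p > 0\<close>] by blast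
  have "p \<ge> 0" using \<open>p > 1\<close> by simp
  let ?C = "2 powr p + 16 powr p + (32 * t) powr p"
  have "tail p z 1 R \<mu>1 \<le> ennreal (2 powr p) * (\<integral>\<^sup>+ \<omega>. E \<omega> \<partial>M) +
    ennreal ?C * (tail p z 1 (R / 16) \<mu>0 + tail p z T (R / (32 * t)) \<mu>2)"
  proof (rule tail_le_of_pointwise[OF laws(2,1,3) E(1)])
    fix \<omega>
    define S a dX dY dZ where "S = dist (X \<omega>) (Y \<omega>) + dist (Y \<omega>) (Z \<omega>)" and "a = dist (X \<omega>) (Y \<omega>)"
      and "dX = dist (X \<omega>) z" and "dY = dist (Y \<omega>) z" and "dZ = dist (Z \<omega>) z"
    have nn: "S \<ge> 0" "dX \<ge> 0" "dY \<ge> 0" "dZ \<ge> 0" "a \<ge> 0" "a \<le> S"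
      by (auto simp: S_def dX_def dY_def dZ_def a_def)
    define eX eZ where "eX = excess p (R / 16) dX" and "eZ = excess p (R / (32 * t)) (dZ / T)"
    have ee: "eX \<ge> 0" "eZ \<ge> 0" by (auto simp: eX_def eZ_def)
    have "dY \<le> dX + a"
      using dist_triangle[of "Y \<omega>" z "X \<omega>"] by (simp add: a_def dX_def dY_def dist_commute)
    then have "excess p R dY \<le> excess p (R / 2 + R / 2) (dX + a)"
      using \<open>p \<ge> 0\<close> by (intro excess_mono) auto
    also have "\<dots> \<le> 2 powr p * (excess p (R / 2) dX + excess p (R / 2) a)"
      by (intro excess_add \<open>p \<ge> 0\<close>)
    also have "\<dots> \<le> 2 powr p * (eX + excess p (R / 2) a)"
      unfolding eX_def using \<open>R \<ge> 0\<close> \<open>p \<ge> 0\<close> by (intro mult_left_mono add_mono excess_mono) auto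
    finally have main: "excess p R dY \<le> 2 powr p * eX + 2 powr p * excess p (R / 2) a"
      by (simp add: distrib_left)
    consider "ennreal (S powr p) \<le> E \<omega>" | "a \<le> 2 * l * S" "S \<le> 2 * dist (X \<omega>) (Z \<omega>)"
      using good[of \<omega>] unfolding S_def a_def by blast
    then have "ennreal (excess p R dY) \<le> ennreal (2 powr p) * E \<omega> + ennreal ?C * (ennreal eX + ennreal eZ)"
    proof cases
      case 1
      have "excess p (R / 2) a \<le> a powr p"
        using \<open>R \<ge> 0\<close> \<open>p \<ge> 0\<close> nn l by (intro excess_le_powr) auto
      also have "\<dots> \<le> S powr p"
        using nn \<open>p \<ge> 0\<close> by (intro powr_mono2) auto
      finally have "2 powr p * excess p (R / 2) a \<le> 2 powr p * S powr p"
        by (intro mult_left_mono) auto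
      moreover have "2 powr p * eX \<le> ?C * (eX + eZ)"
        using ee by (intro mult_mono) auto
      ultimately have "excess p R dY \<le> 2 powr p * S powr p + ?C * (eX + eZ)"
        using main by linarith
      then have "ennreal (excess p R dY) \<le> ennreal (2 powr p) * ennreal (S powr p) +
          ennreal ?C * (ennreal eX + ennreal eZ)"
        using ee by (simp flip: ennreal_plus ennreal_mult add: ennreal_leI)
      also have "\<dots> \<le> ennreal (2 powr p) * E \<omega> + ennreal ?C * (ennreal eX + ennreal eZ)"
        using 1 by (intro add_mono mult_left_mono) auto
      finally show ?thesis .
    next
      case 2
      have "S \<le> 2 * dX + 2 * dZ"
        using 2 dist_triangle2[of "X \<omega>" "Z \<omega>" z] by (simp add: dX_def dZ_def)
      then have "2 * l * S \<le> 2 * l * (2 * dX + 2 * dZ)" using l by (intro mult_left_mono) auto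
      with 2 have "a \<le> 4 * (l * dX) + 4 * (l * dZ)" by (simp add: algebra_simps)
      moreover have "l * dX \<le> dX" using l nn by (simp add: mult_left_le_one_le)
      \<comment> \<open>Since \<open>l = t / L\<close>, this is where \<open>T <= 2 * L\<close>
        converts the normalisation by \<open>L\<close> into the one by \<open>T\<close>.\<close>
      moreover have "l * dZ \<le> 2 * t * (dZ / T)"
      proof -
        have "t * (T * dZ) \<le> t * (2 * L * dZ)"
          using nn t \<open>T \<le> 2 * L\<close> by (intro mult_left_mono mult_right_mono) auto
        then show ?thesis using l \<open>T > 0\<close> by (simp add: l_def field_simps)
      qed
      ultimately have "a \<le> 4 * dX + 8 * t * (dZ / T)" by linarith
      then have "excess p (R / 2) a \<le> excess p (4 * (R / 16) + 8 * t * (R / (32 * t))) (4 * dX + 8 * t * (dZ / T))"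
        using \<open>p \<ge> 0\<close> t by (intro excess_mono) auto
      also have "\<dots> \<le> 2 powr p * (excess p (4 * (R / 16)) (4 * dX) + excess p (8 * t * (R / (32 * t))) (8 * t * (dZ / T)))"
        by (intro excess_add \<open>p \<ge> 0\<close>)
      also have "\<dots> = 2 powr p * (4 powr p * eX + (8 * t) powr p * eZ)"
        unfolding eX_def eZ_def using t by (subst (1 2) excess_scale) auto
      finally have "2 powr p * excess p (R / 2) a \<le> 2 powr p * (2 powr p * (4 powr p * eX + (8 * t) powr p * eZ))"
        by (intro mult_left_mono) auto
      also have "\<dots> = 16 powr p * eX + (32 * t) powr p * eZ"
      proof -
        have "2 powr p * 2 powr p = (4::real) powr p" "4 powr p * 4 powr p = (16::real) powr p"
          "(4::real) powr p * (8 * t) powr p = (32 * t) powr p"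
          using t by (simp_all flip: powr_mult)
        then show ?thesis by (simp add: distrib_left flip: mult.assoc)
      qed
      finally have "excess p R dY \<le> 2 powr p * eX + 16 powr p * eX + (32 * t) powr p * eZ"
        using main by linarith
      also have "\<dots> \<le> ?C * (eX + eZ)"
        using ee by (simp add: algebra_simps)
      finally have "ennreal (excess p R dY) \<le> ennreal ?C * (ennreal eX + ennreal eZ)"
        using ee by (simp flip: ennreal_plus ennreal_mult add: ennreal_leI)
      then show ?thesis by (simp add: add_increasing)
    qed
    then show "ennreal (excess p R (dist (Y \<omega>) z / 1)) \<le> ennreal (2 powr p) * E \<omega> + ennreal ?C *
        (ennreal (excess p (R / 16) (dist (X \<omega>) z / 1)) + ennreal (excess p (R / (32 * t)) (dist (Z \<omega>) z / T)))"
      by (simp add: dX_def dY_def dZ_def eX_def eZ_def)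
  qed
  also have "ennreal (2 powr p) * (\<integral>\<^sup>+ \<omega>. E \<omega> \<partial>M) \<le> ennreal (2 powr p) * ennreal (e / 2 powr p)"
    by (intro mult_left_mono E) auto
  also have "\<dots> = ennreal e" using \<open>e > 0\<close> by (simp flip: ennreal_mult)
  finally show "tail p z 1 R \<mu>1 \<le> ennreal ?C * (tail p z 1 (R / 16) \<mu>0 + tail p z T (R / (32 * t)) \<mu>2) + ennreal e"
    by (simp add: add.commute)
qed

section \<open>Hopf--Rinow and geodesics towards a ray\<close>

text \<open>On a curve of length below \<open>r + s\<close>, the intermediate value theorem gives a
  point at distance exactly \<open>r\<close> from \<open>x\<close>; the partition of the curve at
  that point leaves less than \<open>s\<close> for the rest.\<close>

lemma length_space_intermediate:
  fixes x y :: "'a::metric_space"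
  assumes "length_space TYPE('a)" "dist x y < r + s" "r \<ge> 0" "s > 0"
  obtains z where "dist x z \<le> r" "dist z y < s"
proof (cases "dist x y \<le> r")
  case True
  then show ?thesis using that[of y] assms by simp
next
  case False
  have "ereal (dist x y) = (INF g \<in> {g. continuous_on {0..1} g \<and> g 0 = x \<and> g 1 = y}. curve_length g 0 1)"
    using assms(1) unfolding length_space_def by blast
  moreover have "ereal (dist x y) < ereal (r + s)" using assms(2) by simp
  ultimately have "(INF g \<in> {g. continuous_on {0..1} g \<and> g 0 = x \<and> g 1 = y}. curve_length g 0 1) < ereal (r + s)"
    by (simp only:)
  then obtain g where g: "continuous_on {0..1} g" "g 0 = x" "g 1 = y" "curve_length g 0 1 < ereal (r + s)"
    unfolding INF_less_iff by blast
  have "\<exists>u\<ge>0. u \<le> 1 \<and> dist x (g u) = r"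
    using g False assms by (intro IVT') (auto intro!: continuous_intros)
  then obtain u where u: "0 \<le> u" "u \<le> 1" "dist x (g u) = r" by auto
  define t :: "nat \<Rightarrow> real" where "t i = (if i = 0 then 0 else if i = 1 then u else 1)" for i
  define P where "P = (2 :: nat, t)"
  have "P \<in> {(n, t). t 0 = 0 \<and> t n = 1 \<and> (\<forall>i<n. t i \<le> t (Suc i))}"
    using u by (auto simp: t_def P_def)
  then have "ereal (\<Sum>i<fst P. dist (g (snd P i)) (g (snd P (Suc i)))) \<le> curve_length g 0 1"
    unfolding curve_length_def by (rule SUP_upper)
  then have "ereal (dist x (g u) + dist (g u) y) \<le> curve_length g 0 1"
    using g by (simp add: numeral_2_eq_2 t_def P_def)
  then have "ereal (dist x (g u) + dist (g u) y) < ereal (r + s)"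
    using g(4) by (rule le_less_trans)
  then have "dist x (g u) + dist (g u) y < r + s" by simp
  then show ?thesis using that[of "g u"] u by simp
qed

text \<open>Hopf-Rinow argument on the supremum \<open>\<rho>\<close> of the compact radii. The ball
  of radius \<open>\<rho>\<close> is totally bounded because its points lie within
  \<open>e / 2\<close> of a smaller compact ball; finitely many compact neighbourhoods then cover a
  strictly larger ball, contradicting the supremum.\<close>

lemma compact_cball_length_space:
  fixes x :: "'a::complete_space"
  assumes len: "length_space TYPE('a)" and lc: "locally_compact TYPE('a)"
  shows "compact (cball x r)"
proof (rule ccontr)
  assume non: "\<not> compact (cball x r)"
  define I where "I = {s. s \<ge> 0 \<and> compact (cball x s)}"
  define \<rho> where "\<rho> = Sup I"
  have "r \<ge> 0"
  proof (rule ccontr)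
    assume "\<not> r \<ge> 0"
    then have "cball x r = {}" by simp
    then show False using non by simp
  qed
  have bound: "s \<le> r" if "s \<in> I" for s
  proof (rule ccontr)
    assume "\<not> s \<le> r"
    then have "cball x r = cball x s \<inter> cball x r" by auto
    moreover have "compact (cball x s \<inter> cball x r)"
      using that by (intro compact_Int_closed) (auto simp: I_def)
    ultimately show False using non by simp
  qed
  have "0 \<in> I" by (simp add: I_def)
  have bdd: "bdd_above I" using bound by (auto simp: bdd_above_def)
  have "\<rho> \<ge> 0" unfolding \<rho>_def by (rule cSup_upper[OF \<open>0 \<in> I\<close> bdd])
  have "compact (cball x \<rho>)"
    unfolding compact_eq_totally_bounded
  proof (intro conjI allI impI)
    show "Topological_Spaces.complete (cball x \<rho>)" by (simp add: complete_eq_closed)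
    fix e :: real assume "0 < e"
    have "\<rho> - e / 2 < Sup I" using \<open>0 < e\<close> by (simp add: \<rho>_def)
    then obtain s where s: "s \<in> I" "\<rho> - e / 2 < s"
      using less_cSupE[of "\<rho> - e / 2" I] \<open>0 \<in> I\<close> by blast
    then have "compact (cball x s)" by (simp add: I_def)
    then obtain k where k: "finite k" "cball x s \<subseteq> (\<Union>y\<in>k. ball y (e / 2))"
      using compact_eq_totally_bounded[of "cball x s"] \<open>0 < e\<close> by (meson half_gt_zero)
    have "cball x \<rho> \<subseteq> (\<Union>y\<in>k. ball y e)"
    proof
      fix y assume "y \<in> cball x \<rho>"
      then have "dist x y < s + e / 2" using s by simp
      then obtain z where z: "dist x z \<le> s" "dist z y < e / 2"
        using length_space_intermediate[OF len] s \<open>0 < e\<close> by (force simp: I_def)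
      then obtain w where "w \<in> k" "dist w z < e / 2" using k by (force simp: subset_eq)
      then show "y \<in> (\<Union>y\<in>k. ball y e)"
        using z dist_triangle_half_r[of z w e y] by (force simp: dist_commute intro: dist_triangle_half_r)
    qed
    then show "\<exists>k. finite k \<and> cball x \<rho> \<subseteq> (\<Union>y\<in>k. ball y e)" using k by blast
  qed
  have "\<forall>y::'a. \<exists>U K. open U \<and> compact K \<and> y \<in> U \<and> U \<subseteq> K"
    using lc by (simp add: locally_compact_def)
  then obtain U K where UK: "\<And>y::'a. open (U y)" "\<And>y::'a. compact (K y)" "\<And>y::'a. y \<in> U y" "\<And>y::'a. U y \<subseteq> K y"
    by metis
  obtain F where F: "finite F" "cball x \<rho> \<subseteq> (\<Union>y\<in>F. U y)"
    using compactE_image[OF \<open>compact (cball x \<rho>)\<close>, of "cball x \<rho>" U] UK by (metis UN_I subsetI)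
  have "open (\<Union>y\<in>F. U y)" using UK(1) by blast
  then obtain d where d: "d > 0" "(\<Union>y\<in>cball x \<rho>. ball y d) \<subseteq> (\<Union>y\<in>F. U y)"
    using compact_subset_open_imp_ball_epsilon_subset[OF \<open>compact (cball x \<rho>)\<close> _ F(2)] by blast
  have "cball x (\<rho> + d / 2) \<subseteq> (\<Union>y\<in>F. K y)"
  proof
    fix y assume "y \<in> cball x (\<rho> + d / 2)"
    then have "dist x y < \<rho> + d" using d by simp
    then obtain z where "dist x z \<le> \<rho>" "dist z y < d"
      using length_space_intermediate[OF len] \<open>\<rho> \<ge> 0\<close> d by metis
    then have "y \<in> (\<Union>y\<in>F. U y)" using d(2) by (force simp: subset_eq)
    then show "y \<in> (\<Union>y\<in>F. K y)" using UK by blast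
  qed
  then have "cball x (\<rho> + d / 2) = (\<Union>y\<in>F. K y) \<inter> cball x (\<rho> + d / 2)" by auto
  moreover have "compact ((\<Union>y\<in>F. K y) \<inter> cball x (\<rho> + d / 2))"
    using F UK by (intro compact_Int_closed compact_UN) auto
  ultimately have "\<rho> + d / 2 \<in> I" using \<open>\<rho> \<ge> 0\<close> d by (simp add: I_def)
  then have "\<rho> + d / 2 \<le> \<rho>" unfolding \<rho>_def by (rule cSup_upper[OF _ bdd])
  then show False using d by simp
qed

section \<open>Rays and the geodesics ending on them: lengths and uniform tails\<close>

lemma unit_speed_ray_Pp: "unit_speed_ray p m \<Longrightarrow> s \<ge> 0 \<Longrightarrow> m s \<in> Pp p"
  by (simp add: unit_speed_ray_def is_ray_def)

lemma unit_speed_ray_Wp: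
  assumes "unit_speed_ray p m" "s \<ge> 0" "t \<ge> 0"
  shows "Wp p (m s) (m t) = \<bar>s - t\<bar>"
proof -
  have "Wp p (m s) (m t) = \<bar>s - t\<bar> * Wp p (m 0) (m 1)"
    using assms unfolding unit_speed_ray_def is_ray_def by blast
  then show ?thesis using assms by (simp add: unit_speed_ray_def)
qed

lemma geodesics_T_D:
  assumes "c \<in> geodesics_T p \<mu> \<nu>"
  shows "c 0 = \<mu>" "c (Wp p \<mu> \<nu>) = \<nu>" "\<And>t. 0 \<le> t \<Longrightarrow> t \<le> Wp p \<mu> \<nu> \<Longrightarrow> c t \<in> Pp p"
    "\<And>s t. 0 \<le> s \<Longrightarrow> s \<le> Wp p \<mu> \<nu> \<Longrightarrow> 0 \<le> t \<Longrightarrow> t \<le> Wp p \<mu> \<nu> \<Longrightarrow> Wp p (c s) (c t) = \<bar>s - t\<bar>"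
  using assms by (auto simp: geodesics_T_def)

text \<open>The triangle inequality gives \<open>tn n <= K + Wp p (\<mu> n) (m (tn n))\<close> with
  \<open>K\<close> independent of \<open>n\<close>, and \<open>K\<close> is at most half of
  \<open>tn n\<close> eventually. This supplies \<open>T <= 2 * L\<close> for the interior estimate
  and shows that every fixed time is eventually reached.\<close>

lemma distance_to_ray_ge:
  fixes m :: "real \<Rightarrow> 'a::metric_space measure"
  assumes sep: "separable_space TYPE('a)" and "p > 1" and ray: "unit_speed_ray p m"
    and \<nu>0: "\<nu>0 \<in> Pp p" and tn: "filterlim tn at_top sequentially" and \<mu>: "\<forall>n. \<mu> n \<in> Pp p"
    and conv: "(\<lambda>n. Wp p (\<mu> n) \<nu>0) \<longlonglongrightarrow> 0"
  shows "\<forall>\<^sub>F n in sequentially. tn n \<le> 2 * Wp p (\<mu> n) (m (tn n))"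
proof -
  define K where "K = Wp p (m 0) \<nu>0 + 1"
  have K: "K \<ge> 1" by (simp add: K_def)
  have "\<forall>\<^sub>F n in sequentially. tn n \<ge> 2 * K" using tn by (simp add: filterlim_at_top)
  moreover have "\<forall>\<^sub>F n in sequentially. Wp p (\<mu> n) \<nu>0 < 1" using conv by (rule order_tendstoD) simp
  ultimately show ?thesis
  proof eventually_elim
    case (elim n)
    have P: "m 0 \<in> Pp p" "m (tn n) \<in> Pp p" "\<mu> n \<in> Pp p"
      using unit_speed_ray_Pp[OF ray] elim K \<mu> by auto
    have "tn n = Wp p (m 0) (m (tn n))"
      using unit_speed_ray_Wp[OF ray, of 0 "tn n"] elim K by simp
    also have "\<dots> \<le> Wp p (m 0) (\<mu> n) + Wp p (\<mu> n) (m (tn n))"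
      using Wp_triangle[OF sep \<open>p > 1\<close>] P by blast
    also have "Wp p (m 0) (\<mu> n) \<le> Wp p (m 0) \<nu>0 + Wp p \<nu>0 (\<mu> n)"
      using Wp_triangle[OF sep \<open>p > 1\<close>] P \<nu>0 by blast
    also have "Wp p \<nu>0 (\<mu> n) = Wp p (\<mu> n) \<nu>0"
      using Wp_commute[OF sep] P \<nu>0 \<open>p > 1\<close> by simp
    finally have "tn n \<le> K + Wp p (\<mu> n) (m (tn n))" using elim by (simp add: K_def)
    then show ?case using elim by simp
  qed
qed

text \<open>The endpoint estimate involves only the two fixed measures \<open>m 0\<close> and
  \<open>m 1\<close>, so one threshold serves all times.\<close>

lemma ray_tails_vanish:
  fixes m :: "real \<Rightarrow> 'a::metric_space measure"
  assumes sep: "separable_space TYPE('a)" and "p > 1" and ray: "unit_speed_ray p m" and "e > 0"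
  obtains R where "R \<ge> 0" "\<And>t. t > 1 \<Longrightarrow> tail p z t R (m t) \<le> ennreal e"
proof -
  have "p > 0" using \<open>p > 1\<close> by simp
  define C where "C = 2 powr p + 8 powr p"
  have "C > 0" by (simp add: C_def add_pos_pos)
  define e' where "e' = e / (2 * C)"
  have "e' > 0" using \<open>e > 0\<close> \<open>C > 0\<close> by (simp add: e'_def)
  note P = unit_speed_ray_Pp[OF ray]
  obtain R0 where R0: "R0 \<ge> 0" "tail p z 1 R0 (m 0) \<le> ennreal e'"
    using tail_vanishes[OF P \<open>p > 0\<close> \<open>e' > 0\<close>, of 0] by auto
  obtain R1 where R1: "R1 \<ge> 0" "tail p z 1 R1 (m 1) \<le> ennreal e'"
    using tail_vanishes[OF P \<open>p > 0\<close> \<open>e' > 0\<close>, of 1] by auto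
  define R where "R = 8 * max R0 R1"
  have "R \<ge> 0" using R0 by (simp add: R_def)
  have "tail p z t R (m t) \<le> ennreal e" if "t > 1" for t
  proof -
    have "tail p z t R (m t) \<le> ennreal (2 powr p + 8 powr p) * (tail p z 1 (R / 8) (m 0) + tail p z 1 (R / 8) (m 1))"
      using that \<open>R \<ge> 0\<close> \<open>p > 1\<close> unit_speed_ray_Wp[OF ray]
      by (intro geodesic_endpoint_tail[OF sep] P) auto
    also have "\<dots> \<le> ennreal C * (ennreal e' + ennreal e')"
      unfolding C_def[symmetric]
      using order_trans[OF tail_antimono R0(2)] order_trans[OF tail_antimono R1(2)] \<open>p > 0\<close>
      by (intro mult_left_mono add_mono) (auto simp: R_def)
    also have "\<dots> = ennreal (C * (e' + e'))"
      using \<open>C > 0\<close> \<open>e' > 0\<close> by (simp flip: ennreal_plus ennreal_mult)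
    also have "C * (e' + e') = e" using \<open>C > 0\<close> by (simp add: e'_def)
    finally show ?thesis .
  qed
  then show ?thesis using that \<open>R \<ge> 0\<close> by blast
qed

lemma geodesics_to_ray_tails_vanish:
  fixes m :: "real \<Rightarrow> 'a::metric_space measure"
  assumes sep: "separable_space TYPE('a)" and "p > 1" and ray: "unit_speed_ray p m"
    and \<nu>0: "\<nu>0 \<in> Pp p" and tn: "filterlim tn at_top sequentially" and \<mu>: "\<forall>n. \<mu> n \<in> Pp p"
    and conv: "(\<lambda>n. Wp p (\<mu> n) \<nu>0) \<longlonglongrightarrow> 0"
    and geo: "\<forall>n. c n \<in> geodesics_T p (\<mu> n) (m (tn n))" and "t \<ge> 0" "e > 0"
  obtains R where "R \<ge> 0" "\<forall>\<^sub>F n in sequentially. tail p z 1 R (c n t) \<le> ennreal e"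
proof (cases "t = 0")
  \<comment> \<open>The three-point estimate needs an interior point; at time 0 the tails are those
    of the convergent starting measures.\<close>
  case True
  have "p > 0" using \<open>p > 1\<close> by simp
  have "c n t = \<mu> n" for n
    using geodesics_T_D(1) geo True by blast
  then show ?thesis
    using tails_vanish_of_Wp_convergent[OF sep \<mu> \<nu>0 \<open>p > 0\<close> conv \<open>e > 0\<close>] that by auto
next
  case False
  then have "t > 0" using \<open>t \<ge> 0\<close> by simp
  have "p > 0" using \<open>p > 1\<close> by simp
  define C where "C = 2 powr p + 16 powr p + (32 * t) powr p"
  have "C > 0" by (simp add: C_def add_pos_nonneg)
  define e' where "e' = e / (2 * C)"
  have "e' > 0" using \<open>e > 0\<close> \<open>C > 0\<close> by (simp add: e'_def)
  obtain R0 where R0: "R0 \<ge> 0" "\<forall>\<^sub>F n in sequentially. tail p z 1 R0 (\<mu> n) \<le> ennreal e'"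
    using tails_vanish_of_Wp_convergent[OF sep \<mu> \<nu>0 \<open>p > 0\<close> conv \<open>e' > 0\<close>] by blast
  obtain R1 where R1: "R1 \<ge> 0" "\<And>t. t > 1 \<Longrightarrow> tail p z t R1 (m t) \<le> ennreal e'"
    using ray_tails_vanish[OF sep \<open>p > 1\<close> ray \<open>e' > 0\<close>] by blast
  define R where "R = max (16 * R0) (32 * t * R1)"
  have R: "R \<ge> 0" "R0 \<le> R / 16" "R1 \<le> R / (32 * t)"
    using R0 \<open>t > 0\<close> by (auto simp: R_def field_simps)
  \<comment> \<open>The 2 puts \<open>tn n\<close> beyond 1, as the ray tails require; with
    \<open>tn n\<close> at most twice the length, \<open>3 * t\<close> makes the length at least
    \<open>3 * t / 2\<close>, hence larger than \<open>t\<close>.\<close>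
  have "\<forall>\<^sub>F n in sequentially. tn n \<ge> max 2 (3 * t)" using tn unfolding filterlim_at_top by blast
  then have "\<forall>\<^sub>F n in sequentially. tail p z 1 R (c n t) \<le> ennreal e"
    using R0(2) distance_to_ray_ge[OF sep \<open>p > 1\<close> ray \<nu>0 tn \<mu> conv]
  proof eventually_elim
    case (elim n)
    let ?L = "Wp p (\<mu> n) (m (tn n))"
    have tL: "t < ?L" using elim \<open>t > 0\<close> by simp
    note g = geodesics_T_D[of "c n" p "\<mu> n" "m (tn n)"]
    have gn: "c n \<in> geodesics_T p (\<mu> n) (m (tn n))" using geo by blast
    have W: "Wp p (\<mu> n) (c n t) = t" "Wp p (c n t) (m (tn n)) = ?L - t"
      using g(4)[OF gn, of 0 t] g(4)[OF gn, of t ?L] g(1,2)[OF gn] tL \<open>t > 0\<close> by auto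
    have "tail p z 1 R (c n t) \<le> ennreal (2 powr p + 16 powr p + (32 * t) powr p) *
      (tail p z 1 (R / 16) (\<mu> n) + tail p z (tn n) (R / (32 * t)) (m (tn n)))"
      using tL \<open>t > 0\<close> elim R \<mu> g(3)[OF gn, of t] \<open>p > 1\<close> unit_speed_ray_Pp[OF ray, of "tn n"]
      by (intro geodesic_interior_tail[OF sep, where L="?L"] W refl) auto
    also have "\<dots> \<le> ennreal C * (ennreal e' + ennreal e')"
      unfolding C_def[symmetric]
      using order_trans[OF tail_antimono elim(2)] order_trans[OF tail_antimono R1(2)[of "tn n"]] \<open>p > 0\<close> R elim
      by (intro mult_left_mono add_mono) auto
    also have "\<dots> = ennreal (C * (e' + e'))"
      using \<open>C > 0\<close> \<open>e' > 0\<close> by (simp flip: ennreal_plus ennreal_mult)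
    also have "C * (e' + e') = e" using \<open>C > 0\<close> by (simp add: e'_def)
    finally show ?case .
  qed
  then show ?thesis using that R by blast
qed

section \<open>Compactness from Skorohod's theorem on the line\<close>

text \<open>Digits 0 and 1 in base 3: all later digits together contribute at most half a unit of
  the current one, so a differing digit leaves a definite gap, which fails in base 2.\<close>

definition ternary :: "(nat \<Rightarrow> bool) \<Rightarrow> real" where
  "ternary a = (\<Sum>j. of_bool (a j) / 3 ^ Suc j)"

lemma third_sums: "(\<lambda>j. 1 / 3 ^ Suc j :: real) sums (1 / 2)"
  using sums_mult[OF geometric_sums[of "1/3 :: real"], of "1/3"] by (simp add: power_divide)

lemma ternary_summable: "summable (\<lambda>j. of_bool (a j) / 3 ^ Suc j :: real)"
  by (rule summable_comparison_test'[OF sums_summable[OF third_sums], of 0]) auto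

lemma ternary_bounds: "0 \<le> ternary a" "ternary a \<le> 1 / 2"
proof -
  show "0 \<le> ternary a"
    unfolding ternary_def by (intro suminf_nonneg ternary_summable) auto
  have "ternary a \<le> (\<Sum>j. 1 / 3 ^ Suc j)"
    unfolding ternary_def by (intro suminf_le ternary_summable sums_summable[OF third_sums]) auto
  then show "ternary a \<le> 1 / 2" using sums_unique[OF third_sums] by simp
qed

lemma ternary_head: "ternary a = (of_bool (a 0) + ternary (\<lambda>j. a (Suc j))) / 3"
proof -
  have "ternary a = of_bool (a 0) / 3 + (\<Sum>j. of_bool (a (Suc j)) / 3 ^ Suc (Suc j))"
    unfolding ternary_def using suminf_split_head[OF ternary_summable[of a]] by simp
  also have "(\<Sum>j. of_bool (a (Suc j)) / 3 ^ Suc (Suc j)) = ternary (\<lambda>j. a (Suc j)) / 3"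
    unfolding ternary_def using suminf_divide[OF ternary_summable[of "\<lambda>j. a (Suc j)"], of 3]
    by (simp add: mult.commute)
  finally show ?thesis by (simp add: add_divide_distrib)
qed

text \<open>The leading digits differ by 1 and the remainders by at most \<open>1 / 2\<close>, all
  divided by 3.\<close>

lemma first_digit_gap:
  fixes u v :: real
  assumes "a \<noteq> b" "0 \<le> u" "u \<le> 1 / 2" "0 \<le> v" "v \<le> 1 / 2"
  shows "1 / 6 \<le> \<bar>(of_bool a + u) / 3 - (of_bool b + v) / 3\<bar>"
proof (cases a)
  case True
  then have e: "of_bool a = (1::real)" "of_bool b = (0::real)" using assms by auto
  show ?thesis unfolding e using assms(2-) by (intro order_trans[OF _ abs_ge_self]) (simp add: field_simps)
next
  case False
  then have e: "of_bool a = (0::real)" "of_bool b = (1::real)" using assms by auto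
  show ?thesis unfolding e using assms(2-) by (intro order_trans[OF _ abs_ge_minus_self]) (simp add: field_simps)
qed

lemma ternary_gap:
  assumes "a i \<noteq> b i"
  shows "(1 / 3) ^ Suc i / 2 \<le> \<bar>ternary a - ternary b\<bar>"
  using assms
proof (induction i arbitrary: a b)
  case 0
  have "1 / 6 \<le> \<bar>ternary a - ternary b\<bar>"
    unfolding ternary_head[of a] ternary_head[of b]
    using 0 by (intro first_digit_gap ternary_bounds)
  then show ?case by simp
next
  case (Suc i)
  let ?a = "\<lambda>j. a (Suc j)" and ?b = "\<lambda>j. b (Suc j)"
  show ?case
  proof (cases "a 0 = b 0")
    case True
    then have "\<bar>ternary a - ternary b\<bar> = \<bar>ternary ?a - ternary ?b\<bar> / 3"
      unfolding ternary_head[of a] ternary_head[of b] by (simp add: abs_if field_simps)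
    moreover have "(1 / 3) ^ Suc i / 2 \<le> \<bar>ternary ?a - ternary ?b\<bar>"
      by (rule Suc.IH) (rule Suc.prems)
    ultimately show ?thesis by simp
  next
    case False
    have "1 / 6 \<le> \<bar>ternary a - ternary b\<bar>"
      unfolding ternary_head[of a] ternary_head[of b]
      using False by (intro first_digit_gap ternary_bounds)
    moreover have "(1 / 3 :: real) ^ Suc (Suc i) \<le> (1 / 3) ^ 1"
      by (intro power_decreasing) auto
    ultimately show ?thesis by simp
  qed
qed

text \<open>The ternary digits record membership in a countable base of balls; the integer part keeps
  \<open>h\<close> proper, so that a convergent sequence of codes comes from a bounded sequence of points.\<close>

lemma real_encoding_exists:
  fixes z :: "'a::metric_space"
  assumes sep: "separable_space TYPE('a)" and proper: "\<And>r. compact (cball z r)"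
  obtains h :: "'a \<Rightarrow> real" where "h \<in> borel_measurable borel"
    "\<And>x. dist x z \<le> h x + 1" "\<And>x. 0 \<le> h x" "\<And>x. h x \<le> dist x z + 1"
    "\<And>R e. e > 0 \<Longrightarrow> \<exists>\<delta>>0. \<forall>x y. dist x z \<le> R \<longrightarrow> \<bar>h x - h y\<bar> < \<delta> \<longrightarrow> dist x y < e"
proof -
  obtain D :: "'a set" where D: "countable D" "closure D = UNIV"
    using sep unfolding separable_space_def by auto
  define d where "d = from_nat_into D"
  have cover: "\<exists>i. dist (d i) x < e" if e: "e > 0" for x e
  proof -
    obtain y where "y \<in> D" "dist y x < e"
      using D(2) closure_approachable[of x D] e by (metis UNIV_I)
    then show ?thesis
      using from_nat_into_surj[OF D(1) \<open>y \<in> D\<close>] by (auto simp: d_def)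
  qed
  \<comment> \<open>Digit \<open>j\<close> codes a pair \<open>(i, k)\<close> and asks whether
    \<open>x\<close> lies in the ball of radius \<open>1 / Suc k\<close> around the
    \<open>i\<close>-th dense point.\<close>
  define a where "a x j \<longleftrightarrow> dist (d (fst (prod_decode j))) x < 1 / Suc (snd (prod_decode j))" for x j
  define h where "h x = of_int \<lfloor>dist x z\<rfloor> + ternary (a x)" for x
  have dm [measurable]: "(\<lambda>x. dist x y) \<in> borel_measurable borel" "(\<lambda>x. dist y x) \<in> borel_measurable borel" for y :: 'a
    by (intro borel_measurable_continuous_onI continuous_intros)+
  have [measurable]: "Measurable.pred borel (\<lambda>x. a x j)" for j
    unfolding a_def by measurable
  have h: "h \<in> borel_measurable borel"
    unfolding h_def ternary_def of_bool_def by measurable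
  have fl: "of_int \<lfloor>dist x z\<rfloor> \<le> dist x z" "dist x z < of_int \<lfloor>dist x z\<rfloor> + 1" for x
    by linarith+
  have lower: "dist x z \<le> h x + 1" for x
    using fl(2)[of x] ternary_bounds(1)[of "a x"] unfolding h_def by linarith
  have nonneg: "0 \<le> h x" for x
    using ternary_bounds(1)[of "a x"] by (simp add: h_def)
  have upper: "h x \<le> dist x z + 1" for x
    using fl(1)[of x] ternary_bounds(2)[of "a x"] unfolding h_def by linarith
  have "\<exists>\<delta>>0. \<forall>x y. dist x z \<le> R \<longrightarrow> \<bar>h x - h y\<bar> < \<delta> \<longrightarrow> dist x y < e" if "e > 0" for R e
  proof -
    obtain k where k: "1 / real (Suc k) < e / 2"
      using \<open>e > 0\<close> nat_approx_posE[of "e / 2"] by auto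
    have "cball z R \<subseteq> (\<Union>i. ball (d i) (1 / Suc k))"
      using cover[of "1 / Suc k"] by auto
    then obtain I where I: "finite I" "cball z R \<subseteq> (\<Union>i\<in>I. ball (d i) (1 / Suc k))"
      using compactE_image[OF proper[of R], of UNIV "\<lambda>i. ball (d i) (1 / Suc k)"] by auto
    \<comment> \<open>The last digit needed to decide membership in a finite cover of
      \<open>cball z R\<close> at scale \<open>k\<close>. Only \<open>x\<close> has to be in that
      ball: agreement of one digit puts \<open>y\<close> into the same small ball. The inserted 0
      covers an empty \<open>I\<close>.\<close>
    define J where "J = Max (insert 0 ((\<lambda>i. prod_encode (i, k)) ` I))"
    define \<delta> :: real where "\<delta> = (1 / 3) ^ Suc J / 2"
    have "\<delta> > 0" by (simp add: \<delta>_def)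
    \<comment> \<open>A gap below \<open>1 / 6\<close> forces equal integer parts, since distinct
      ones with fractional codes in \<open>[0, 1/2]\<close> differ by at least
      \<open>1 / 2\<close>.\<close>
    have "(1 / 3 :: real) ^ Suc J \<le> (1 / 3) ^ 1" by (intro power_decreasing) auto
    then have "\<delta> \<le> 1 / 6" by (simp add: \<delta>_def)
    have "dist x y < e" if xy: "dist x z \<le> R" "\<bar>h x - h y\<bar> < \<delta>" for x y
    proof -
      obtain i where i: "i \<in> I" "dist (d i) x < 1 / Suc k"
      proof -
        have "x \<in> cball z R" using xy(1) by (simp add: dist_commute)
        then have "x \<in> (\<Union>i\<in>I. ball (d i) (1 / Suc k))" using I(2) by blast
        then show ?thesis using that by auto
      qed
      let ?j = "prod_encode (i, k)"
      have "?j \<le> J" unfolding J_def using I(1) i(1) by (intro Max_ge) auto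
      have feq: "\<lfloor>dist x z\<rfloor> = \<lfloor>dist y z\<rfloor>"
      proof (rule ccontr)
        assume "\<lfloor>dist x z\<rfloor> \<noteq> \<lfloor>dist y z\<rfloor>"
        then have "1 \<le> \<bar>real_of_int \<lfloor>dist x z\<rfloor> - real_of_int \<lfloor>dist y z\<rfloor>\<bar>" by linarith
        then show False
          using xy(2) \<open>\<delta> \<le> 1 / 6\<close> ternary_bounds[of "a x"] ternary_bounds[of "a y"]
          unfolding h_def by linarith
      qed
      have "a x ?j" using i by (simp add: a_def)
      have "a y ?j"
      proof (rule ccontr)
        assume "\<not> a y ?j"
        then have "(1 / 3) ^ Suc ?j / 2 \<le> \<bar>ternary (a x) - ternary (a y)\<bar>"
          using \<open>a x ?j\<close> by (intro ternary_gap) simp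
        moreover have "\<delta> \<le> (1 / 3) ^ Suc ?j / 2"
          unfolding \<delta>_def using \<open>?j \<le> J\<close> by (intro divide_right_mono power_decreasing) auto
        ultimately show False using xy(2) feq by (simp add: h_def)
      qed
      then have "dist (d i) y < 1 / Suc k" by (simp add: a_def)
      then show "dist x y < e" using i(2) k dist_triangle3[of x y "d i"] by linarith
    qed
    then show ?thesis using \<open>\<delta> > 0\<close> by blast
  qed
  then show ?thesis using that h lower nonneg upper by blast
qed

text \<open>On each image of a bounded set the inverse is uniformly continuous, so completeness
  extends it to the closure, a Borel set. The countably many pieces are then patched
  together.\<close>

lemma encoding_left_inverse:
  fixes h :: "'a::complete_space \<Rightarrow> real"
  assumes lower: "\<And>x. dist x z \<le> h x + 1"
    and modulus: "\<And>R e. e > 0 \<Longrightarrow> \<exists>\<delta>>0. \<forall>x y. dist x z \<le> R \<longrightarrow> \<bar>h x - h y\<bar> < \<delta> \<longrightarrow> dist x y < e"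
  obtains g where "g \<in> borel_measurable borel" "\<And>x. g (h x) = x"
proof -
  have inj: "x = y" if eq: "h x = h y" for x y
  proof (rule ccontr)
    assume "x \<noteq> y"
    then obtain \<delta> where \<delta>: "\<delta> > 0"
      "\<forall>x' y'. dist x' z \<le> dist x z \<longrightarrow> \<bar>h x' - h y'\<bar> < \<delta> \<longrightarrow> dist x' y' < dist x y"
      using modulus[of "dist x y" "dist x z"] by auto
    have "dist x y < dist x y" using \<delta>(2)[rule_format, of x y] \<delta>(1) eq by simp
    then show False by simp
  qed
  define S where "S k = {x. dist x z \<le> real k}" for k
  have "\<exists>g. continuous_on (closure (h ` S k)) g \<and> (\<forall>x\<in>S k. g (h x) = x)" for k
  proof -
    have inv: "inv h (h x) = x" for x using inj by (intro inv_f_f injI)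
    have "uniformly_continuous_on (h ` S k) (inv h)"
      unfolding uniformly_continuous_on_def
    proof (intro allI impI)
      fix e :: real assume "e > 0"
      then obtain \<delta> where "\<delta> > 0" "\<forall>x y. dist x z \<le> real k \<longrightarrow> \<bar>h x - h y\<bar> < \<delta> \<longrightarrow> dist x y < e"
        using modulus by blast
      then show "\<exists>\<delta>>0. \<forall>x\<in>h ` S k. \<forall>x'\<in>h ` S k. dist x' x < \<delta> \<longrightarrow> dist (inv h x') (inv h x) < e"
        by (intro exI[of _ \<delta>]) (auto simp: inv S_def dist_real_def)
    qed
    from uniformly_continuous_on_extension_on_closure[OF this]
    obtain g where g: "uniformly_continuous_on (closure (h ` S k)) g" "\<And>y. y \<in> h ` S k \<Longrightarrow> inv h y = g y"
      by metis
    have "g (h x) = x" if "x \<in> S k" for x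
      using g(2)[of "h x"] inv[of x] that by auto
    then show ?thesis
      using uniformly_continuous_imp_continuous[OF g(1)] by blast
  qed
  then obtain g where g: "\<And>k. continuous_on (closure (h ` S k)) (g k)" "\<And>k x. x \<in> S k \<Longrightarrow> g k (h x) = x"
    by metis
  define G where "G k y = (if y \<in> closure (h ` S k) then g k y else z)" for k y
  have G: "G k \<in> borel_measurable borel" for k
    unfolding G_def by (intro borel_measurable_continuous_on_if g) auto
  \<comment> \<open>The piece is chosen from the code alone: by \<open>lower\<close>,
    \<open>h x + 1\<close> bounds the distance of \<open>x\<close> to \<open>z\<close>.\<close>
  have "(\<lambda>y. G (nat \<lceil>y + 1\<rceil>) y) \<in> borel_measurable borel"
    by (rule measurable_compose_countable[OF G]) measurable
  moreover have "G (nat \<lceil>h x + 1\<rceil>) (h x) = x" for x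
  proof -
    have "x \<in> S (nat \<lceil>h x + 1\<rceil>)"
      using lower[of x] of_nat_ceiling[of "h x + 1"] unfolding S_def by (simp del: of_nat_nat)
    then show ?thesis
      using g(2) closure_subset[of "h ` S (nat \<lceil>h x + 1\<rceil>)"] by (auto simp: G_def)
  qed
  ultimately show ?thesis using that by blast
qed

section \<open>Tightness, Skorohod representation and convergent subsequences\<close>

text \<open>The finitely many initial measures are absorbed by enlarging the threshold; tightness
  demands a bound for every index.\<close>

lemma tails_vanish_uniformly:
  assumes \<mu>: "\<And>n. \<mu> n \<in> Pp p" and "p > 0" "e > 0"
    and ev: "\<exists>R\<ge>0. \<forall>\<^sub>F n in sequentially. tail p z 1 R (\<mu> n) \<le> ennreal e"
  obtains R where "R \<ge> 0" "\<And>n. tail p z 1 R (\<mu> n) \<le> ennreal e"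
proof -
  obtain R0 N where R0: "R0 \<ge> 0" "\<And>n. n \<ge> N \<Longrightarrow> tail p z 1 R0 (\<mu> n) \<le> ennreal e"
    using ev by (auto simp: eventually_sequentially)
  have "\<exists>R\<ge>0. tail p z 1 R (\<mu> n) \<le> ennreal e" for n
    using tail_vanishes[OF \<mu> \<open>p > 0\<close> \<open>e > 0\<close>] by metis
  then obtain r where r: "\<And>n. r n \<ge> 0" "\<And>n. tail p z 1 (r n) (\<mu> n) \<le> ennreal e"
    by metis
  define R where "R = Max (insert R0 (r ` {..<N}))"
  have R: "R0 \<le> R" "\<And>n. n < N \<Longrightarrow> r n \<le> R" by (auto simp: R_def)
  have "tail p z 1 R (\<mu> n) \<le> ennreal e" for n
    using order_trans[OF tail_antimono R0(2)[of n]] order_trans[OF tail_antimono r(2)[of n]] R \<open>p > 0\<close>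
    by (cases "n < N") auto
  then show ?thesis using that R R0 by (meson order_trans)
qed

text \<open>Markov's inequality: beyond \<open>R + 1\<close> the integrand is at least 1.\<close>

lemma emeasure_far_le_tail:
  assumes "\<mu> \<in> Pp p" "p > 0"
  shows "emeasure \<mu> {x. dist x z > R + 1} \<le> tail p z 1 R \<mu>"
proof -
  have s: "sets \<mu> = sets borel" using assms by (simp add: Pp_def)
  have "open {x. dist x z > R + 1}" by (intro open_Collect_less continuous_intros)
  then have "{x. dist x z > R + 1} \<in> sets \<mu>" by (simp add: s)
  then have "emeasure \<mu> {x. dist x z > R + 1} = (\<integral>\<^sup>+ x. indicator {x. dist x z > R + 1} x \<partial>\<mu>)"
    by simp
  also have "\<dots> \<le> (\<integral>\<^sup>+ x. ennreal (excess p R (dist x z / 1)) \<partial>\<mu>)"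
  proof (rule nn_integral_mono)
    fix x
    have "1 \<le> excess p R (dist x z)" if "dist x z > R + 1"
      unfolding excess_def using that \<open>p > 0\<close> by (intro ge_one_powr_ge_zero) auto
    then show "indicator {x. dist x z > R + 1} x \<le> ennreal (excess p R (dist x z / 1))"
      by (auto split: split_indicator simp flip: ennreal_1 intro!: ennreal_leI)
  qed
  finally show ?thesis by (simp add: tail_def)
qed

lemma tight_encoding:
  fixes h :: "'a::metric_space \<Rightarrow> real"
  assumes \<mu>: "\<And>n. \<mu> n \<in> Pp p" and "p > 0"
    and h: "h \<in> borel_measurable borel" "\<And>x. 0 \<le> h x" "\<And>x. h x \<le> dist x z + 1"
    and tails: "\<And>e. e > 0 \<Longrightarrow> \<exists>R\<ge>0. \<forall>\<^sub>F n in sequentially. tail p z 1 R (\<mu> n) \<le> ennreal e"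
  shows "tight (\<lambda>n. distr (\<mu> n) borel h)"
  unfolding tight_def
proof (intro conjI allI impI)
  have ps: "prob_space (\<mu> n)" and s: "sets (\<mu> n) = sets borel" for n
    using \<mu>[of n] by (auto simp: Pp_def)
  have hm [measurable]: "h \<in> borel_measurable (\<mu> n)" for n
    using h(1) by (simp cong: measurable_cong_sets add: s)
  show "real_distribution (distr (\<mu> n) borel h)" for n
  proof -
    interpret prob_space "\<mu> n" by (rule ps)
    show ?thesis by (rule real_distribution_distr) (rule hm)
  qed
  fix \<epsilon> :: real assume "\<epsilon> > 0"
  then obtain R where R: "R \<ge> 0" "\<And>n. tail p z 1 R (\<mu> n) \<le> ennreal (\<epsilon> / 2)"
    using tails_vanish_uniformly[OF \<mu> \<open>p > 0\<close> _ tails, of "\<epsilon> / 2"] by (metis half_gt_zero)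
  show "\<exists>a b. a < b \<and> (\<forall>n. 1 - \<epsilon> < measure (distr (\<mu> n) borel h) {a<..b})"
  \<comment> \<open>Codes are nonnegative, so -1 is a safe open left end; a point within
    \<open>R + 1\<close> of \<open>z\<close> has code at most \<open>R + 2\<close>.\<close>
  proof (rule exI[of _ "-1"], rule exI[of _ "R + 2"], intro conjI allI)
    fix n
    interpret prob_space "\<mu> n" by (rule ps)
    have sp: "space (\<mu> n) = UNIV" using sets_eq_imp_space_eq[OF s] by simp
    have "open {x. dist x z > R + 1}" by (intro open_Collect_less continuous_intros)
    then have [measurable]: "{x. dist x z > R + 1} \<in> sets (\<mu> n)" by (simp add: s)
    have "ennreal (measure (\<mu> n) {x. dist x z > R + 1}) \<le> ennreal (\<epsilon> / 2)"
      using order_trans[OF emeasure_far_le_tail[OF \<mu> \<open>p > 0\<close>] R(2)] by (simp flip: emeasure_eq_measure)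
    then have far: "measure (\<mu> n) {x. dist x z > R + 1} \<le> \<epsilon> / 2"
      using \<open>\<epsilon> > 0\<close> by simp
    have "1 - measure (\<mu> n) {x. dist x z > R + 1} = measure (\<mu> n) (space (\<mu> n) - {x. dist x z > R + 1})"
      by (subst prob_compl) auto
    also have "\<dots> \<le> measure (\<mu> n) (h -` {-1<..R + 2} \<inter> space (\<mu> n))"
    proof (rule finite_measure_mono)
      show "space (\<mu> n) - {x. dist x z > R + 1} \<subseteq> h -` {-1<..R + 2} \<inter> space (\<mu> n)"
      proof
        fix x assume "x \<in> space (\<mu> n) - {x. dist x z > R + 1}"
        then show "x \<in> h -` {-1<..R + 2} \<inter> space (\<mu> n)"
          using h(2)[of x] h(3)[of x] by auto
      qed
    qed measurable
    also have "\<dots> = measure (distr (\<mu> n) borel h) {-1<..R + 2}"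
      by (simp add: measure_distr)
    finally show "1 - \<epsilon> < measure (distr (\<mu> n) borel h) {-1<..R + 2}"
      using far \<open>\<epsilon> > 0\<close> by linarith
  qed (use R in simp)
qed

text \<open>The coded laws are tight on the line, so a subsequence has almost surely convergent
  representatives, decoded by \<open>g\<close>. The limit of the codes need not itself be a code;
  the limit \<open>V\<close> is instead obtained in the space from the modulus of \<open>h\<close>
  and completeness.\<close>

lemma Skorohod_proper:
  fixes \<mu> :: "nat \<Rightarrow> 'a::complete_space measure"
  assumes sep: "separable_space TYPE('a)" and proper: "\<And>r. compact (cball z r)"
    and \<mu>: "\<And>n. \<mu> n \<in> Pp p" and "p > 0"
    and tails: "\<And>e. e > 0 \<Longrightarrow> \<exists>R\<ge>0. \<forall>\<^sub>F n in sequentially. tail p z 1 R (\<mu> n) \<le> ennreal e"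
  obtains r :: "nat \<Rightarrow> nat" and \<Omega> :: "real measure" and X V where "strict_mono r" "prob_space \<Omega>"
    "\<And>n. has_law \<Omega> (X n) (\<mu> (r n))" "V \<in> borel_measurable \<Omega>"
    "AE \<omega> in \<Omega>. (\<lambda>n. X n \<omega>) \<longlonglongrightarrow> V \<omega>"
proof -
  obtain h :: "'a \<Rightarrow> real" where h: "h \<in> borel_measurable borel"
    "\<And>x. dist x z \<le> h x + 1" "\<And>x. 0 \<le> h x" "\<And>x. h x \<le> dist x z + 1"
    "\<And>R e. e > 0 \<Longrightarrow> \<exists>\<delta>>0. \<forall>x y. dist x z \<le> R \<longrightarrow> \<bar>h x - h y\<bar> < \<delta> \<longrightarrow> dist x y < e"
    using real_encoding_exists[OF sep proper] by blast
  obtain g where g [measurable]: "g \<in> borel_measurable borel" and gh: "\<And>x. g (h x) = x"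
    using encoding_left_inverse[OF h(2,5)] by blast
  define \<mu>' where "\<mu>' n = distr (\<mu> n) borel h" for n
  have s: "sets (\<mu> n) = sets borel" for n using \<mu>[of n] by (auto simp: Pp_def)
  have hm: "h \<in> borel_measurable (\<mu> n)" for n
    using h(1) by (simp cong: measurable_cong_sets add: s)
  have tight: "tight \<mu>'"
    unfolding \<mu>'_def[abs_def] by (rule tight_encoding[OF \<mu> \<open>p > 0\<close> h(1,3,4) tails])
  then obtain r M where r: "strict_mono r" and M: "real_distribution M" "weak_conv_m (\<mu>' \<circ> id \<circ> r) M"
    using tight_imp_convergent_subsubsequence[of \<mu>' id] by (auto simp: strict_mono_def)
  have rd: "real_distribution ((\<mu>' \<circ> id \<circ> r) n)" for n
    using tight by (simp add: tight_def)
  obtain \<Omega> :: "real measure" and Y :: "nat \<Rightarrow> real \<Rightarrow> real" and Y' :: "real \<Rightarrow> real" where \<Omega>: "prob_space \<Omega>"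
    and Y: "\<forall>n. Y n \<in> borel_measurable \<Omega>" "\<forall>n. distr \<Omega> borel (Y n) = (\<mu>' \<circ> id \<circ> r) n"
      "\<forall>\<omega>\<in>space \<Omega>. (\<lambda>n. Y n \<omega>) \<longlonglongrightarrow> Y' \<omega>"
    using Skorohod[OF rd M] by blast
  have Ym [measurable]: "Y n \<in> borel_measurable \<Omega>" and Yd: "distr \<Omega> borel (Y n) = \<mu>' (r n)" for n
    using Y by simp_all
  have Yc: "(\<lambda>n. Y n \<omega>) \<longlonglongrightarrow> Y' \<omega>" if "\<omega> \<in> space \<Omega>" for \<omega>
    using Y that by blast
  define X where "X n \<omega> = g (Y n \<omega>)" for n \<omega>
  have Xm [measurable]: "X n \<in> borel_measurable \<Omega>" for n unfolding X_def by measurable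
  have law: "has_law \<Omega> (X n) (\<mu> (r n))" for n
  proof -
    have "X n = g \<circ> Y n" by (auto simp: X_def)
    then have "distr \<Omega> borel (X n) = distr (distr \<Omega> borel (Y n)) borel g"
      by (simp add: distr_distr[OF g Ym])
    also have "\<dots> = distr (\<mu> (r n)) borel (g \<circ> h)"
      unfolding Yd \<mu>'_def by (rule distr_distr[OF g hm])
    also have "g \<circ> h = (\<lambda>x. x)" using gh by auto
    also have "distr (\<mu> (r n)) borel (\<lambda>x. x) = \<mu> (r n)"
      by (rule distr_id2) (simp add: s)
    finally show ?thesis by (simp add: has_law_def Xm)
  qed
  \<comment> \<open>The event that every representative is a genuine code. It has full measure
    because each \<open>Y n\<close> has the law of a pushforward under \<open>h\<close>.\<close>
  define E where "E = {\<omega> \<in> space \<Omega>. \<forall>n. h (X n \<omega>) = Y n \<omega>}"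
  have hX [measurable]: "(\<lambda>\<omega>. h (X n \<omega>)) \<in> borel_measurable \<Omega>" for n
    by (rule measurable_compose[OF Xm h(1)])
  have [measurable]: "E \<in> sets \<Omega>" unfolding E_def by measurable
  have "AE \<omega> in \<Omega>. \<forall>n. h (X n \<omega>) = Y n \<omega>"
    unfolding AE_all_countable
  proof
    fix n
    have m: "(\<lambda>y. h (g y)) \<in> borel_measurable borel" by (rule measurable_compose[OF g h(1)])
    have fixed: "{y \<in> space borel. h (g y) = y} \<in> sets borel" using m by measurable
    have "AE y in distr (\<mu> (r n)) borel h. h (g y) = y"
      unfolding AE_distr_iff[OF hm fixed] by (simp add: gh)
    then have "AE y in distr \<Omega> borel (Y n). h (g y) = y" unfolding Yd \<mu>'_def .
    then show "AE \<omega> in \<Omega>. h (X n \<omega>) = Y n \<omega>"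
      unfolding AE_distr_iff[OF Ym fixed] X_def .
  qed
  then have AE_E: "AE \<omega> in \<Omega>. \<omega> \<in> E" using AE_space by eventually_elim (simp add: E_def)
  \<comment> \<open>A convergent real sequence of codes is bounded, so its points stay in one ball,
    where the modulus of \<open>h\<close> makes them Cauchy.\<close>
  have conv: "convergent (\<lambda>n. X n \<omega>)" if \<omega>: "\<omega> \<in> E" for \<omega>
  proof (rule Cauchy_convergent)
    have hY: "h (X n \<omega>) = Y n \<omega>" for n using \<omega> by (simp add: E_def)
    have lim: "(\<lambda>n. Y n \<omega>) \<longlonglongrightarrow> Y' \<omega>" using \<omega> Yc by (simp add: E_def)
    then have "Bseq (\<lambda>n. Y n \<omega>)" by (rule convergentI[THEN convergent_imp_Bseq])
    then obtain K where K: "\<And>n. \<bar>Y n \<omega>\<bar> \<le> K" by (auto simp: Bseq_def)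
    have bd: "dist (X n \<omega>) z \<le> K + 1" for n
      using h(2)[of "X n \<omega>"] K[of n] by (simp add: hY)
    show "Cauchy (\<lambda>n. X n \<omega>)"
    proof (rule metric_CauchyI)
      fix e :: real assume "e > 0"
      then obtain \<delta> where \<delta>: "\<delta> > 0" "\<forall>x y. dist x z \<le> K + 1 \<longrightarrow> \<bar>h x - h y\<bar> < \<delta> \<longrightarrow> dist x y < e"
        using h(5) by blast
      obtain N where N: "\<And>m n. m \<ge> N \<Longrightarrow> n \<ge> N \<Longrightarrow> dist (Y m \<omega>) (Y n \<omega>) < \<delta>"
        using LIMSEQ_imp_Cauchy[OF lim] \<delta>(1) unfolding Cauchy_def by blast
      have "dist (X m \<omega>) (X n \<omega>) < e" if "m \<ge> N" "n \<ge> N" for m n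
        using \<delta>(2) bd N[OF that] by (simp add: hY dist_real_def)
      then show "\<exists>N. \<forall>m\<ge>N. \<forall>n\<ge>N. dist (X m \<omega>) (X n \<omega>) < e" by blast
    qed
  qed
  define V where "V \<omega> = (if \<omega> \<in> E then lim (\<lambda>n. X n \<omega>) else z)" for \<omega>
  have "V \<in> borel_measurable \<Omega>"
  proof (rule borel_measurable_LIMSEQ_metric[where f="\<lambda>n \<omega>. if \<omega> \<in> E then X n \<omega> else z"])
    show "(\<lambda>\<omega>. if \<omega> \<in> E then X n \<omega> else z) \<in> borel_measurable \<Omega>" for n by measurable
    show "(\<lambda>n. if \<omega> \<in> E then X n \<omega> else z) \<longlonglongrightarrow> V \<omega>" for \<omega>
      using conv[of \<omega>] by (auto simp: V_def convergent_LIMSEQ_iff)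
  qed
  moreover have "AE \<omega> in \<Omega>. (\<lambda>n. X n \<omega>) \<longlonglongrightarrow> V \<omega>"
    using AE_E by eventually_elim (use conv in \<open>auto simp: V_def convergent_LIMSEQ_iff\<close>)
  ultimately show ?thesis using that r \<Omega> law by blast
qed

lemma tendsto_excess:
  assumes "(u \<longlongrightarrow> l) F" "p > 0"
  shows "((\<lambda>n. excess p R (u n)) \<longlongrightarrow> excess p R l) F"
  unfolding excess_def using assms
  by (intro tendsto_powr' tendsto_intros) auto

text \<open>Vitali's argument: almost sure convergence together with uniformly small tails gives
  convergence of p-th moments of the distance, and the pair of \<open>X n\<close> and
  \<open>V\<close> is an admissible coupling.\<close>

lemma Wp_convergent_subsequence:
  fixes \<mu> :: "nat \<Rightarrow> 'a::complete_space measure"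
  assumes sep: "separable_space TYPE('a)" and proper: "\<And>r. compact (cball z r)"
    and \<mu>: "\<And>n. \<mu> n \<in> Pp p" and "p > 0"
    and tails: "\<And>e. e > 0 \<Longrightarrow> \<exists>R\<ge>0. \<forall>\<^sub>F n in sequentially. tail p z 1 R (\<mu> n) \<le> ennreal e"
  obtains r :: "nat \<Rightarrow> nat" and \<nu> where "strict_mono r" "\<nu> \<in> Pp p" "(\<lambda>n. Wp p (\<mu> (r n)) \<nu>) \<longlonglongrightarrow> 0"
proof -
  obtain r :: "nat \<Rightarrow> nat" and \<Omega> :: "real measure" and X V where r: "strict_mono r" and "prob_space \<Omega>"
    and law: "\<And>n. has_law \<Omega> (X n) (\<mu> (r n))" and Vm: "V \<in> borel_measurable \<Omega>"
    and conv: "AE \<omega> in \<Omega>. (\<lambda>n. X n \<omega>) \<longlonglongrightarrow> V \<omega>"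
    using Skorohod_proper[OF sep proper \<mu> \<open>p > 0\<close> tails] by blast
  interpret prob_space \<Omega> by fact
  define \<nu> where "\<nu> = distr \<Omega> borel V"
  have lawV: "has_law \<Omega> V \<nu>" using Vm by (simp add: has_law_def \<nu>_def)
  have Xm: "X n \<in> borel_measurable \<Omega>" for n using law by (rule has_law_measurable)
  have [measurable]: "(\<lambda>\<omega>. ennreal (excess p R (dist (X n \<omega>) z / 1))) \<in> borel_measurable \<Omega>" for R n
    by (rule measurable_compose[OF Xm excess_dist_measurable])
  have [measurable]: "(\<lambda>\<omega>. ennreal (excess p R (dist (V \<omega>) z / 1))) \<in> borel_measurable \<Omega>" for R
    by (rule measurable_compose[OF Vm excess_dist_measurable])
  have [measurable]: "(\<lambda>\<omega>. dist (X n \<omega>) (V \<omega>)) \<in> borel_measurable \<Omega>" for n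
    by (intro borel_measurable_dist_separable[OF sep] Xm Vm)
  have tailX: "tail p z 1 R (\<mu> (r n)) = (\<integral>\<^sup>+ \<omega>. ennreal (excess p R (dist (X n \<omega>) z / 1)) \<partial>\<Omega>)" for n R
    unfolding tail_def by (rule nn_integral_has_law[OF law excess_dist_measurable])
  have tailV: "tail p z 1 R \<nu> = (\<integral>\<^sup>+ \<omega>. ennreal (excess p R (dist (V \<omega>) z / 1)) \<partial>\<Omega>)" for R
    unfolding tail_def by (rule nn_integral_has_law[OF lawV excess_dist_measurable])
  have unif: "\<exists>R\<ge>0. (\<forall>n. tail p z 1 R (\<mu> (r n)) \<le> ennreal e) \<and> tail p z 1 R \<nu> \<le> ennreal e" if e: "e > 0" for e
  proof -
    obtain R where R: "R \<ge> 0" "\<And>n. tail p z 1 R (\<mu> n) \<le> ennreal e"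
      using tails_vanish_uniformly[OF \<mu> \<open>p > 0\<close> e tails[OF e]] by blast
    \<comment> \<open>Fatou's lemma passes the uniform tail bound to the limit law.\<close>
    have "tail p z 1 R \<nu> = (\<integral>\<^sup>+ \<omega>. liminf (\<lambda>n. ennreal (excess p R (dist (X n \<omega>) z / 1))) \<partial>\<Omega>)"
      unfolding tailV using conv
    proof (intro nn_integral_cong_AE, eventually_elim)
      case (elim \<omega>)
      have "(\<lambda>n. ennreal (excess p R (dist (X n \<omega>) z / 1))) \<longlonglongrightarrow> ennreal (excess p R (dist (V \<omega>) z / 1))"
        using elim \<open>p > 0\<close> by (intro tendsto_ennrealI tendsto_excess tendsto_intros) auto
      then show ?case by (intro lim_imp_Liminf[symmetric]) auto
    qed
    also have "\<dots> \<le> liminf (\<lambda>n. \<integral>\<^sup>+ \<omega>. ennreal (excess p R (dist (X n \<omega>) z / 1)) \<partial>\<Omega>)"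
      by (rule nn_integral_liminf) measurable
    also have "\<dots> \<le> ennreal e"
      unfolding tailX[symmetric] using R(2) by (intro Liminf_le) auto
    finally show ?thesis using R by blast
  qed
  have "\<nu> \<in> Pp p"
  proof -
    obtain R where R: "R \<ge> 0" "tail p z 1 R \<nu> \<le> ennreal 1" using unif[of 1] by auto
    \<comment> \<open>A single finite tail suffices for membership in \<open>Pp\<close>: the
      distance is at most \<open>R\<close> plus its overshoot above \<open>R\<close>.\<close>
    have "(\<integral>\<^sup>+ x. ennreal (dist x z powr p) \<partial>\<nu>) \<le>
      (\<integral>\<^sup>+ x. ennreal (2 powr p) * (ennreal (R powr p) + ennreal (excess p R (dist x z / 1))) \<partial>\<nu>)"
    proof (rule nn_integral_mono)
      fix x
      have "dist x z powr p \<le> (R + max 0 (dist x z - R)) powr p"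
        using \<open>p > 0\<close> by (intro powr_mono2) auto
      also have "\<dots> \<le> 2 powr p * (R powr p + excess p R (dist x z))"
        unfolding excess_def using \<open>p > 0\<close> R by (intro powr_add_le) auto
      finally show "ennreal (dist x z powr p) \<le>
          ennreal (2 powr p) * (ennreal (R powr p) + ennreal (excess p R (dist x z / 1)))"
        by (simp flip: ennreal_plus ennreal_mult add: ennreal_leI)
    qed
    also have "\<dots> = ennreal (2 powr p) * (ennreal (R powr p) * emeasure \<nu> (space \<nu>) + tail p z 1 R \<nu>)"
    proof -
      have m: "(\<lambda>x. ennreal (excess p R (dist x z / 1))) \<in> borel_measurable \<nu>"
        unfolding \<nu>_def by (simp only: measurable_distr_eq1 excess_dist_measurable)
      show ?thesis
        unfolding tail_def
        by (simp only: nn_integral_cmult nn_integral_add nn_integral_const m borel_measurable_const borel_measurable_add)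
    qed
    also have "\<dots> < \<infinity>"
    proof -
      have "tail p z 1 R \<nu> < \<infinity>" using R(2) by (rule le_less_trans) simp
      moreover have "emeasure \<nu> (space \<nu>) = 1"
        using prob_space.emeasure_space_1[OF prob_space_distr[OF Vm]] by (simp add: \<nu>_def)
      ultimately show ?thesis by (simp add: ennreal_mult_less_top less_top)
    qed
    finally show ?thesis
      using prob_space_distr[OF Vm] by (auto simp: Pp_def \<nu>_def)
  qed
  moreover have "(\<lambda>n. Wp p (\<mu> (r n)) \<nu>) \<longlonglongrightarrow> 0"
  proof (rule LIMSEQ_I)
    fix A :: real assume "A > 0"
    define c where "c = (2::real) powr p"
    have c: "c > 0" by (simp add: c_def)
    \<comment> \<open>Chosen so that the final bound \<open>c * e + c * c * (e + e)\<close> equals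
      \<open>(A / 2) powr p\<close>.\<close>
    define e where "e = (A / 2) powr p / (c + 2 * c * c)"
    have den: "c + 2 * c * c > 0" using c by (simp add: add_pos_pos)
    have "e > 0" using \<open>A > 0\<close> den by (simp add: e_def)
    obtain R where R: "R \<ge> 0" "\<And>n. tail p z 1 R (\<mu> (r n)) \<le> ennreal e" "tail p z 1 R \<nu> \<le> ennreal e"
      using unif[OF \<open>e > 0\<close>] by metis
    let ?d = "\<lambda>n \<omega>. dist (X n \<omega>) (V \<omega>)"
    \<comment> \<open>The distance is cut at \<open>2 * R\<close>: the bounded part vanishes by
      dominated convergence, and the overshoot is controlled by the tails of both variables at
      \<open>R\<close>.\<close>
    have "(\<lambda>n. \<integral>\<^sup>+ \<omega>. ennreal (min (?d n \<omega>) (2 * R) powr p) \<partial>\<Omega>) \<longlonglongrightarrow> (\<integral>\<^sup>+ \<omega>. 0 \<partial>\<Omega>)"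
    proof (rule nn_integral_dominated_convergence[where w="\<lambda>_. ennreal ((2 * R) powr p)"])
      show "AE \<omega> in \<Omega>. ennreal (min (?d n \<omega>) (2 * R) powr p) \<le> ennreal ((2 * R) powr p)" for n
        using R(1) \<open>p > 0\<close> by (intro AE_I2 ennreal_leI powr_mono2) auto
      show "AE \<omega> in \<Omega>. (\<lambda>n. ennreal (min (?d n \<omega>) (2 * R) powr p)) \<longlonglongrightarrow> 0"
        using conv
      proof eventually_elim
        case (elim \<omega>)
        have "(\<lambda>n. ?d n \<omega>) \<longlonglongrightarrow> 0" using tendsto_dist[OF elim tendsto_const[of "V \<omega>"]] by simp
        then have "(\<lambda>n. min (?d n \<omega>) (2 * R)) \<longlonglongrightarrow> min 0 (2 * R)" by (intro tendsto_min tendsto_const)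
        then have "(\<lambda>n. min (?d n \<omega>) (2 * R) powr p) \<longlonglongrightarrow> min 0 (2 * R) powr p"
          using \<open>p > 0\<close> R(1) by (intro tendsto_powr' tendsto_const) auto
        then have "(\<lambda>n. min (?d n \<omega>) (2 * R) powr p) \<longlonglongrightarrow> 0"
          using R(1) \<open>p > 0\<close> by (simp add: min_def)
        then show ?case using tendsto_ennrealI[of _ 0] by simp
      qed
    qed (auto simp: emeasure_space_1)
    then have "\<forall>\<^sub>F n in sequentially. (\<integral>\<^sup>+ \<omega>. ennreal (min (?d n \<omega>) (2 * R) powr p) \<partial>\<Omega>) < ennreal e"
      using \<open>e > 0\<close> by (intro order_tendstoD) auto
    then have "\<forall>\<^sub>F n in sequentially. Wp p (\<mu> (r n)) \<nu> \<le> A / 2"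
    proof eventually_elim
      case (elim n)
      have "(\<integral>\<^sup>+ \<omega>. ennreal (?d n \<omega> powr p) \<partial>\<Omega>) \<le> (\<integral>\<^sup>+ \<omega>. ennreal c * ennreal (min (?d n \<omega>) (2 * R) powr p) +
        ennreal (c * c) * (ennreal (excess p R (dist (X n \<omega>) z / 1)) + ennreal (excess p R (dist (V \<omega>) z / 1))) \<partial>\<Omega>)"
      proof (rule nn_integral_mono)
        fix \<omega>
        have "?d n \<omega> powr p \<le> (min (?d n \<omega>) (2 * R) + max 0 (?d n \<omega> - 2 * R)) powr p"
          using \<open>p > 0\<close> by (intro powr_mono2) auto
        also have "\<dots> \<le> c * (min (?d n \<omega>) (2 * R) powr p + excess p (2 * R) (?d n \<omega>))"
          unfolding c_def excess_def using \<open>p > 0\<close> R(1) by (intro powr_add_le) auto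
        also have "excess p (2 * R) (?d n \<omega>) \<le> excess p (R + R) (dist (X n \<omega>) z + dist (V \<omega>) z)"
          using \<open>p > 0\<close> dist_triangle2[of "X n \<omega>" "V \<omega>" z] by (intro excess_mono) auto
        also have "\<dots> \<le> c * (excess p R (dist (X n \<omega>) z) + excess p R (dist (V \<omega>) z))"
          unfolding c_def using \<open>p > 0\<close> by (intro excess_add) auto
        finally have "?d n \<omega> powr p \<le> c * min (?d n \<omega>) (2 * R) powr p +
            c * c * (excess p R (dist (X n \<omega>) z) + excess p R (dist (V \<omega>) z))"
          using c by (simp add: algebra_simps)
        then show "ennreal (?d n \<omega> powr p) \<le> ennreal c * ennreal (min (?d n \<omega>) (2 * R) powr p) +
          ennreal (c * c) * (ennreal (excess p R (dist (X n \<omega>) z / 1)) + ennreal (excess p R (dist (V \<omega>) z / 1)))"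
          using c by (simp flip: ennreal_plus ennreal_mult add: ennreal_leI)
      qed
      also have "\<dots> = ennreal c * (\<integral>\<^sup>+ \<omega>. ennreal (min (?d n \<omega>) (2 * R) powr p) \<partial>\<Omega>) +
          ennreal (c * c) * (tail p z 1 R (\<mu> (r n)) + tail p z 1 R \<nu>)"
        unfolding tailX tailV
        by (subst nn_integral_add, measurable, subst (1 2) nn_integral_cmult, measurable,
            subst nn_integral_add) measurable
      also have "\<dots> \<le> ennreal c * ennreal e + ennreal (c * c) * (ennreal e + ennreal e)"
        using elim R by (intro add_mono mult_left_mono) auto
      also have "\<dots> = ennreal (c * e + c * c * (e + e))"
        using c \<open>e > 0\<close> by (simp flip: ennreal_plus ennreal_mult)
      also have "c * e + c * c * (e + e) = (c + 2 * c * c) * e" by (simp add: algebra_simps)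
      also have "\<dots> = (A / 2) powr p" using den by (simp add: e_def)
      finally show ?case
        using \<open>A > 0\<close> by (intro Wp_leI[OF sep \<open>p > 0\<close> \<open>prob_space \<Omega>\<close> law lawV]) auto
    qed
    then have "\<forall>\<^sub>F n in sequentially. norm (Wp p (\<mu> (r n)) \<nu> - 0) < A"
      by eventually_elim (use \<open>A > 0\<close> in simp)
    then show "\<exists>no. \<forall>n\<ge>no. norm (Wp p (\<mu> (r n)) \<nu> - 0) < A"
      by (simp add: eventually_sequentially)
  qed
  ultimately show ?thesis using that r by blast
qed

section \<open>Existence of the co-ray\<close>

text \<open>Two triangle inequalities bound the difference by the two approximation errors.
  Membership is only eventual because each geodesic is constrained only up to its own
  length.\<close>

lemma Wp_eq_of_limits:
  fixes a b :: "nat \<Rightarrow> 'a::metric_space measure"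
  assumes sep: "separable_space TYPE('a)" and "p > 1"
    and P: "\<forall>\<^sub>F k in sequentially. a k \<in> Pp p" "\<forall>\<^sub>F k in sequentially. b k \<in> Pp p" "\<alpha> \<in> Pp p" "\<beta> \<in> Pp p"
    and lim: "(\<lambda>k. Wp p (a k) \<alpha>) \<longlonglongrightarrow> 0" "(\<lambda>k. Wp p (b k) \<beta>) \<longlonglongrightarrow> 0"
    and eq: "\<forall>\<^sub>F k in sequentially. Wp p (a k) (b k) = c"
  shows "Wp p \<alpha> \<beta> = c"
proof -
  have "p > 0" using \<open>p > 1\<close> by simp
  note tri = Wp_triangle[OF sep \<open>p > 1\<close>] and sym = Wp_commute[OF sep _ _ \<open>p > 0\<close>]
  have bound: "\<forall>\<^sub>F k in sequentially. \<bar>Wp p \<alpha> \<beta> - c\<bar> \<le> Wp p (a k) \<alpha> + Wp p (b k) \<beta>"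
    using P(1,2) eq
  proof eventually_elim
    case (elim k)
    have "Wp p \<alpha> \<beta> \<le> Wp p \<alpha> (a k) + (Wp p (a k) (b k) + Wp p (b k) \<beta>)"
      using tri[of \<alpha> "a k" \<beta>] tri[of "a k" "b k" \<beta>] elim P by simp
    moreover have "Wp p (a k) (b k) \<le> Wp p (a k) \<alpha> + (Wp p \<alpha> \<beta> + Wp p \<beta> (b k))"
      using tri[of "a k" \<alpha> "b k"] tri[of \<alpha> \<beta> "b k"] elim P by simp
    ultimately show ?case
      using elim sym[of \<alpha> "a k"] sym[of \<beta> "b k"] P by (simp add: abs_le_iff)
  qed
  have "(\<lambda>k. Wp p (a k) \<alpha> + Wp p (b k) \<beta>) \<longlonglongrightarrow> 0"
    using tendsto_add[OF lim] by simp
  then have "\<bar>Wp p \<alpha> \<beta> - c\<bar> \<le> 0"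
    by (rule tendsto_lowerbound) (simp_all add: bound)
  then show ?thesis by simp
qed

text \<open>A subsequential limit becomes the limit of the whole sequence if the sequence is
  uniformly approximated by convergent ones. This carries the diagonal subsequence from countably
  many times to all times without another extraction.\<close>

lemma Wp_limit_of_approximations:
  fixes a :: "nat \<Rightarrow> 'a::metric_space measure"
  assumes sep: "separable_space TYPE('a)" and "p > 1"
    and P: "\<forall>\<^sub>F k in sequentially. a k \<in> Pp p" "\<alpha> \<in> Pp p"
    and r: "strict_mono r" "(\<lambda>k. Wp p (a (r k)) \<alpha>) \<longlonglongrightarrow> 0"
    and approx: "\<And>e. e > 0 \<Longrightarrow> \<exists>b \<beta>. \<beta> \<in> Pp p \<and> (\<lambda>k. Wp p (b k) \<beta>) \<longlonglongrightarrow> 0 \<and>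
       (\<forall>\<^sub>F k in sequentially. b k \<in> Pp p \<and> Wp p (a k) (b k) < e)"
  shows "(\<lambda>k. Wp p (a k) \<alpha>) \<longlonglongrightarrow> 0"
proof (rule LIMSEQ_I)
  fix e :: real assume "e > 0"
  have "p > 0" using \<open>p > 1\<close> by simp
  note tri = Wp_triangle[OF sep \<open>p > 1\<close>] and sym = Wp_commute[OF sep _ _ \<open>p > 0\<close>]
  \<comment> \<open>The budget: \<open>2 * e / 5\<close> from \<open>a k\<close> to
    \<open>\<beta>\<close>, and \<open>3 * e / 5\<close> from \<open>\<beta>\<close> to
    \<open>\<alpha>\<close> by way of the subsequence.\<close>
  obtain b \<beta> where b: "\<beta> \<in> Pp p" "(\<lambda>k. Wp p (b k) \<beta>) \<longlonglongrightarrow> 0"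
    "\<forall>\<^sub>F k in sequentially. b k \<in> Pp p \<and> Wp p (a k) (b k) < e / 5"
    using approx[of "e / 5"] \<open>e > 0\<close> by auto
  have "\<forall>\<^sub>F k in sequentially. Wp p (b k) \<beta> < e / 5"
    using b(2) \<open>e > 0\<close> by (intro order_tendstoD) auto
  with P(1) b(3) have near: "\<forall>\<^sub>F k in sequentially. a k \<in> Pp p \<and> Wp p (a k) \<beta> < 2 * e / 5"
  proof eventually_elim
    case (elim k)
    then show ?case using tri[of "a k" "b k" \<beta>] b(1) by simp
  qed
  have "\<forall>\<^sub>F k in sequentially. a (r k) \<in> Pp p \<and> Wp p (a (r k)) \<beta> < 2 * e / 5"
    using near filterlim_subseq[OF r(1)] by (rule eventually_compose_filterlim)
  moreover have "\<forall>\<^sub>F k in sequentially. Wp p (a (r k)) \<alpha> < e / 5"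
    using r(2) \<open>e > 0\<close> by (intro order_tendstoD) auto
  ultimately have "\<forall>\<^sub>F k in sequentially. Wp p \<beta> \<alpha> < 3 * e / 5"
  proof eventually_elim
    case (elim k)
    then show ?case using tri[of \<beta> "a (r k)" \<alpha>] sym[of \<beta> "a (r k)"] b(1) P(2) by simp
  qed
  then have \<beta>\<alpha>: "Wp p \<beta> \<alpha> < 3 * e / 5" by simp
  from near have "\<forall>\<^sub>F k in sequentially. norm (Wp p (a k) \<alpha> - 0) < e"
  proof eventually_elim
    case (elim k)
    then show ?case using tri[of "a k" \<beta> \<alpha>] b(1) P(2) \<beta>\<alpha> by simp
  qed
  then show "\<exists>no. \<forall>n\<ge>no. norm (Wp p (a n) \<alpha> - 0) < e"
    by (simp add: eventually_sequentially)
qed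

theorem theorem4p4:
  fixes p :: real
    and m :: "real \<Rightarrow> 'a::complete_space measure"
    and \<nu>0 :: "'a measure"
    and tn :: "nat \<Rightarrow> real"
    and \<nu>0n :: "nat \<Rightarrow> 'a measure"
    and \<nu>n :: "nat \<Rightarrow> real \<Rightarrow> 'a measure"
  assumes "separable_space TYPE('a)"
    and "\<not> compact (UNIV :: 'a set)"
    and "locally_compact TYPE('a)"
    and "length_space TYPE('a)"
    and "p > 1"
    and "unit_speed_ray p m"
    and "\<nu>0 \<in> Pp p"
    and "incseq tn" and "filterlim tn at_top sequentially"
    and "\<forall>n. \<nu>0n n \<in> Pp p"
    and "(\<lambda>n. Wp p (\<nu>0n n) \<nu>0) \<longlonglongrightarrow> 0"
    and "\<forall>n. \<nu>n n \<in> geodesics_T p (\<nu>0n n) (m (tn n))"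
  shows "\<exists>r::nat \<Rightarrow> nat. strict_mono r \<and>
           (\<exists>\<nu>. is_coray p m \<nu>0 \<nu> \<and>
              (\<forall>t\<ge>0. (\<lambda>k. Wp p (\<nu>n (r k) t) (\<nu> t)) \<longlonglongrightarrow> 0))"
proof -
  note sep = assms(1) and ray = assms(6) and \<nu>0 = assms(7) and tn = assms(9) and \<nu>0n = assms(10)
    and conv = assms(11) and geo = assms(12)
  have "p > 0" using \<open>p > 1\<close> by simp
  note g = geodesics_T_D[OF geo[rule_format]]
  define z :: 'a where "z = undefined"
  have proper: "compact (cball z r)" for r
    by (rule compact_cball_length_space[OF assms(4,3)])
  have long: "\<forall>\<^sub>F n in sequentially. t \<le> Wp p (\<nu>0n n) (m (tn n))" for t
  proof -
    have "\<forall>\<^sub>F n in sequentially. tn n \<ge> 2 * t" using tn unfolding filterlim_at_top by blast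
    then show ?thesis
      using distance_to_ray_ge[OF sep \<open>p > 1\<close> ray \<nu>0 tn \<nu>0n conv] by eventually_elim simp
  qed
  have inP: "\<forall>\<^sub>F n in sequentially. \<nu>n n t \<in> Pp p" if "t \<ge> 0" for t
    using long[of t] by eventually_elim (use g(3) that in blast)
  have speed: "\<forall>\<^sub>F n in sequentially. Wp p (\<nu>n n s) (\<nu>n n t) = \<bar>s - t\<bar>" if "s \<ge> 0" "t \<ge> 0" for s t
    using long[of s] long[of t] by eventually_elim (use g(4) that in blast)
  have sub: "\<exists>r \<sigma>. strict_mono (r :: nat \<Rightarrow> nat) \<and> \<sigma> \<in> Pp p \<and> (\<lambda>k. Wp p (\<nu>n (s (r k)) t) \<sigma>) \<longlonglongrightarrow> 0"
    if "t \<ge> 0" and s: "strict_mono s" for t and s :: "nat \<Rightarrow> nat"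
  proof -
    obtain N where N: "\<And>n. n \<ge> N \<Longrightarrow> \<nu>n n t \<in> Pp p"
      using inP[OF \<open>t \<ge> 0\<close>] by (auto simp: eventually_sequentially)
    \<comment> \<open>The compactness result wants every term in \<open>Pp\<close>, which holds only
      from \<open>N\<close> on; \<open>N\<close> is added back to the extracted indices.\<close>
    define s' where "s' k = s (k + N)" for k
    have s': "strict_mono s'" using s by (simp add: s'_def strict_mono_def)
    have P: "\<nu>n (s' k) t \<in> Pp p" for k
      using N seq_suble[OF s, of "k + N"] by (simp add: s'_def)
    have tails: "\<exists>R\<ge>0. \<forall>\<^sub>F k in sequentially. tail p z 1 R (\<nu>n (s' k) t) \<le> ennreal e" if "e > 0" for e
    proof -
      obtain R where "R \<ge> 0" "\<forall>\<^sub>F n in sequentially. tail p z 1 R (\<nu>n n t) \<le> ennreal e"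
        using geodesics_to_ray_tails_vanish[OF sep \<open>p > 1\<close> ray \<nu>0 tn \<nu>0n conv geo \<open>t \<ge> 0\<close> \<open>e > 0\<close>] by blast
      then show ?thesis using eventually_compose_filterlim[OF _ filterlim_subseq[OF s']] by blast
    qed
    obtain r :: "nat \<Rightarrow> nat" and \<sigma> where "strict_mono r" "\<sigma> \<in> Pp p"
      "(\<lambda>k. Wp p (\<nu>n (s' (r k)) t) \<sigma>) \<longlonglongrightarrow> 0"
      using Wp_convergent_subsequence[where \<mu>="\<lambda>k. \<nu>n (s' k) t", OF sep proper P \<open>p > 0\<close> tails] by blast
    then show ?thesis
      by (intro exI[of _ "\<lambda>k. r k + N"] exI[of _ \<sigma>]) (auto simp: s'_def strict_mono_def)
  qed
  \<comment> \<open>An enumeration of the nonnegative rationals; negative ones are clipped to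
    0.\<close>
  define q :: "nat \<Rightarrow> real" where "q n = max 0 (real_of_rat (from_nat n))" for n
  have q_dense: "\<exists>n. \<bar>t - q n\<bar> < e" if "t \<ge> 0" "e > 0" for t e
  proof -
    obtain x where "t < real_of_rat x" "real_of_rat x < t + e"
      using of_rat_dense[of t "t + e"] \<open>e > 0\<close> by auto
    then show ?thesis using that by (intro exI[of _ "to_nat x"]) (simp add: q_def)
  qed
  interpret subseqs "\<lambda>n s. \<exists>\<sigma>\<in>Pp p. (\<lambda>k. Wp p (\<nu>n (s k) (q n)) \<sigma>) \<longlonglongrightarrow> 0"
  proof
    fix n and s :: "nat \<Rightarrow> nat" assume "strict_mono s"
    then show "\<exists>r'. strict_mono r' \<and> (\<exists>\<sigma>\<in>Pp p. (\<lambda>k. Wp p (\<nu>n ((s \<circ> r') k) (q n)) \<sigma>) \<longlonglongrightarrow> 0)"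
      using sub[of "q n" s] by (auto simp: q_def)
  qed
  define r where "r = diagseq"
  have r: "strict_mono r" unfolding r_def by (rule subseq_diagseq)
  have on_q: "\<exists>\<sigma>\<in>Pp p. (\<lambda>k. Wp p (\<nu>n (r k) (q n)) \<sigma>) \<longlonglongrightarrow> 0" for n
  proof -
    \<comment> \<open>The diagonal sequence refines the \<open>n\<close>-th extraction only after
      its first \<open>Suc n\<close> terms; dropping them does not affect the limit.\<close>
    have "\<exists>\<sigma>\<in>Pp p. (\<lambda>k. Wp p (\<nu>n ((diagseq \<circ> (+) (Suc n)) k) (q n)) \<sigma>) \<longlonglongrightarrow> 0"
    proof (rule diagseq_holds)
      fix i and s r' :: "nat \<Rightarrow> nat"
      assume "strict_mono r'" "\<exists>\<sigma>\<in>Pp p. (\<lambda>k. Wp p (\<nu>n (s k) (q i)) \<sigma>) \<longlonglongrightarrow> 0"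
      then show "\<exists>\<sigma>\<in>Pp p. (\<lambda>k. Wp p (\<nu>n ((s \<circ> r') k) (q i)) \<sigma>) \<longlonglongrightarrow> 0"
        using LIMSEQ_subseq_LIMSEQ[of _ 0 r'] by (fastforce simp: comp_def)
    qed
    then obtain \<sigma> where "\<sigma> \<in> Pp p" "(\<lambda>k. Wp p (\<nu>n (r (k + Suc n)) (q n)) \<sigma>) \<longlonglongrightarrow> 0"
      by (auto simp: r_def add.commute)
    then show ?thesis using LIMSEQ_offset[of "\<lambda>k. Wp p (\<nu>n (r k) (q n)) \<sigma>"] by blast
  qed
  have along: "\<forall>\<^sub>F k in sequentially. Q (r k)" if "\<forall>\<^sub>F n in sequentially. Q n" for Q
    using that filterlim_subseq[OF r] by (rule eventually_compose_filterlim)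
  \<comment> \<open>Limits are used only up to \<open>Wp\<close>-distance 0, so the value at time 0
    is prescribed: the co-ray must start at \<open>\<nu>0\<close> itself.\<close>
  have all: "\<exists>\<sigma>. \<sigma> \<in> Pp p \<and> (\<lambda>k. Wp p (\<nu>n (r k) t) \<sigma>) \<longlonglongrightarrow> 0 \<and> (t = 0 \<longrightarrow> \<sigma> = \<nu>0)" if t: "t \<ge> 0" for t
  proof (cases "t = 0")
    case True
    have "(\<lambda>k. Wp p (\<nu>n (r k) 0) \<nu>0) \<longlonglongrightarrow> 0"
      using LIMSEQ_subseq_LIMSEQ[OF conv r] by (simp add: g(1) comp_def)
    then show ?thesis using True \<nu>0 by blast
  next
    case False
    obtain r' \<sigma> where r': "strict_mono r'" and \<sigma>: "\<sigma> \<in> Pp p" "(\<lambda>k. Wp p (\<nu>n (r (r' k)) t) \<sigma>) \<longlonglongrightarrow> 0"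
      using sub[OF t r] by blast
    have "(\<lambda>k. Wp p (\<nu>n (r k) t) \<sigma>) \<longlonglongrightarrow> 0"
    \<comment> \<open>Nearby times \<open>q n\<close> provide the approximations: by the isometry of
      the curves their distance to time \<open>t\<close> is eventually
      \<open>\<bar>t - q n\<bar>\<close>, for all indices alike.\<close>
    proof (rule Wp_limit_of_approximations[OF sep \<open>p > 1\<close> along[OF inP[OF t]] \<sigma>(1) r' \<sigma>(2)])
      fix e :: real assume "e > 0"
      then obtain n where n: "\<bar>t - q n\<bar> < e" using q_dense[OF t] by blast
      have "q n \<ge> 0" by (simp add: q_def)
      obtain \<beta> where "\<beta> \<in> Pp p" "(\<lambda>k. Wp p (\<nu>n (r k) (q n)) \<beta>) \<longlonglongrightarrow> 0" using on_q by blast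
      moreover have "\<forall>\<^sub>F k in sequentially. \<nu>n (r k) (q n) \<in> Pp p \<and> Wp p (\<nu>n (r k) t) (\<nu>n (r k) (q n)) < e"
        using along[OF inP[OF \<open>q n \<ge> 0\<close>]] along[OF speed[OF t \<open>q n \<ge> 0\<close>]]
        by eventually_elim (use n in simp)
      ultimately show "\<exists>b \<beta>. \<beta> \<in> Pp p \<and> (\<lambda>k. Wp p (b k) \<beta>) \<longlonglongrightarrow> 0 \<and>
         (\<forall>\<^sub>F k in sequentially. b k \<in> Pp p \<and> Wp p (\<nu>n (r k) t) (b k) < e)"
        by (intro exI[of _ "\<lambda>k. \<nu>n (r k) (q n)"] exI[of _ \<beta>]) simp
    qed
    then show ?thesis using \<sigma> False by blast
  qed
  then obtain \<nu> where \<nu>: "\<And>t. t \<ge> 0 \<Longrightarrow> \<nu> t \<in> Pp p"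
    "\<And>t. t \<ge> 0 \<Longrightarrow> (\<lambda>k. Wp p (\<nu>n (r k) t) (\<nu> t)) \<longlonglongrightarrow> 0" "\<nu> 0 = \<nu>0"
    by (metis order_refl)
  have iso: "Wp p (\<nu> s) (\<nu> t) = \<bar>s - t\<bar>" if "s \<ge> 0" "t \<ge> 0" for s t
    using that
    by (intro Wp_eq_of_limits[OF sep \<open>p > 1\<close> along[OF inP] along[OF inP] \<nu>(1) \<nu>(1) \<nu>(2) \<nu>(2) along[OF speed]])
  have "is_ray p \<nu>" unfolding is_ray_def using \<nu>(1) iso by simp
  moreover have "filterlim (\<lambda>k. tn (r k)) at_top sequentially"
    using tn filterlim_subseq[OF r] by (rule filterlim_compose)
  moreover have "(\<lambda>k. Wp p (\<nu>0n (r k)) \<nu>0) \<longlonglongrightarrow> 0"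
    using LIMSEQ_subseq_LIMSEQ[OF conv r] by (simp add: comp_def)
  \<comment> \<open>The extracted subsequence is its own witness: times \<open>tn (r k)\<close>,
    starting measures \<open>\<nu>0n (r k)\<close> and geodesics
    \<open>\<nu>n (r k)\<close>.\<close>
  ultimately have "is_coray p m \<nu>0 \<nu>"
    unfolding is_coray_def using \<nu> \<nu>0n geo
    by (intro conjI exI[of _ "\<lambda>k. tn (r k)"] exI[of _ "\<lambda>k. \<nu>0n (r k)"] exI[of _ "\<lambda>k. \<nu>n (r k)"]) auto
  then show ?thesis using r \<nu>(2) by blast
qed

end
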